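(* Let $t\ge 3$ be an integer with $t\ne 4$. Then $$\operatorname{gp}(C_7\boxtimes C_t)=\begin{cases}10, & t\in\{7,9,11\},\\ 9, & \text{otherwise}.\end{cases}$$
   Context: All graphs are finite, simple and connected. $d_G(u,v)$ is the usual shortest-path distance in $G$. A set $S\subseteq V(G)$ is a general position set of $G$ if no vertex of $S$ lies on a shortest path between two other vertices of $S$; equivalently, $d_G(u,v)\ne d_G(u,w)+d_G(w,v)$ for all pairwise distinct $u,v,w\in S$. The general position number $\operatorname{gp}(G)$ is the maximum cardinality of a general position set of $G$. The strong product $G\boxtimes H$ has vertex set $V(G)\times V(H)$; distinct vertices $(u_x,u_y)$ and $(v_x,v_y)$ are adjacent if and only if ($u_x=v_x$ and $u_yv_y\in E(H)$), or ($u_y=v_y$ and $u_xv_x\in E(G)$), or ($u_xv_x\in E(G)$ and $u_yv_y\in E(H)$). $C_n$ is the cycle on $n$ vertices. *)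

theory Defs
  imports "Graph_Theory.Graph_Theory"
begin

text \<open>
  Finite simple graphs are represented by the locale \<^locale>\<open>pair_graph\<close>: finite, loop-free
  digraphs whose arc set is symmetric, so that an edge \<open>uv\<close> is the pair of arcs
  \<open>(u,v)\<close>, \<open>(v,u)\<close>.
\<close>

definition gdist :: "'a pair_pre_digraph \<Rightarrow> 'a \<Rightarrow> 'a \<Rightarrow> ereal" where
  "gdist G u v = wf_digraph.\<mu> (with_proj G) (\<lambda>_. 1) u v"

definition shortest_path :: "'a pair_pre_digraph \<Rightarrow> 'a \<Rightarrow> ('a \<times> 'a) awalk \<Rightarrow> 'a \<Rightarrow> bool" where
  "shortest_path G u p v \<longleftrightarrow>
     pre_digraph.apath (with_proj G) u p v \<and> ereal (real (length p)) = gdist G u v"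

definition general_position_set :: "'a pair_pre_digraph \<Rightarrow> 'a set \<Rightarrow> bool" where
  "general_position_set G S \<longleftrightarrow>
     S \<subseteq> pverts G \<and>
     (\<forall>u\<in>S. \<forall>v\<in>S. \<forall>w\<in>S. u \<noteq> v \<longrightarrow> w \<noteq> u \<longrightarrow> w \<noteq> v \<longrightarrow>
        \<not> (\<exists>p. shortest_path G u p v \<and> w \<in> set (pawalk_verts u p)))"

definition gp :: "'a pair_pre_digraph \<Rightarrow> nat" where
  "gp G = Max {card S | S. general_position_set G S}"

definition strong_product ::
    "'a pair_pre_digraph \<Rightarrow> 'b pair_pre_digraph \<Rightarrow> ('a \<times> 'b) pair_pre_digraph"
    (infixl \<open>\<boxtimes>\<close> 70) where
  "G \<boxtimes> H =
     \<lparr> pverts = pverts G \<times> pverts H,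
       parcs = {((u\<^sub>x, u\<^sub>y), (v\<^sub>x, v\<^sub>y)) | u\<^sub>x u\<^sub>y v\<^sub>x v\<^sub>y.
         (u\<^sub>x \<in> pverts G \<and> u\<^sub>x = v\<^sub>x \<and> (u\<^sub>y, v\<^sub>y) \<in> parcs H) \<or>
         (u\<^sub>y \<in> pverts H \<and> u\<^sub>y = v\<^sub>y \<and> (u\<^sub>x, v\<^sub>x) \<in> parcs G) \<or>
         ((u\<^sub>x, v\<^sub>x) \<in> parcs G \<and> (u\<^sub>y, v\<^sub>y) \<in> parcs H)} \<rparr>"

text \<open>Meaningful only for \<open>n \<ge> 3\<close>: for \<open>n = 1\<close> the definition yields a loop.\<close>

definition cycle_graph :: "nat \<Rightarrow> nat pair_pre_digraph" where
  "cycle_graph n =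
     \<lparr> pverts = {0..<n},
       parcs = {(i, j). i < n \<and> j < n \<and> (j = (i + 1) mod n \<or> i = (j + 1) mod n)} \<rparr>"

lemma pair_graph_cycle_graph:
  assumes "n \<ge> 3"
  shows "pair_graph (cycle_graph n)"
proof -
  have "finite (parcs (cycle_graph n))"
    by (rule finite_subset[of _ "{0..<n} \<times> {0..<n}"]) (auto simp: cycle_graph_def)
  moreover have no_loop: "Suc i mod n \<noteq> i" if "i < n" for i
    using that assms by (cases "Suc i = n") auto
  moreover note no_loop[symmetric]
  ultimately show ?thesis
    by unfold_locales (auto simp: cycle_graph_def symmetric_def intro!: symI)
qed

lemma strongly_connected_cycle_graph:
  assumes "n \<ge> 3"
  shows "strongly_connected (with_proj (cycle_graph n))"
proof -
  interpret pair_graph "cycle_graph n"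
    using assms by (rule pair_graph_cycle_graph)
  have V: "pverts (cycle_graph n) = {0..<n}"
    by (simp add: cycle_graph_def)
  have from0: "0 \<rightarrow>\<^sup>*\<^bsub>with_proj (cycle_graph n)\<^esub> i" if "i < n" for i
    using that
  proof (induction i)
    case 0
    then show ?case by (simp add: V)
  next
    case (Suc i)
    then have "(i, Suc i) \<in> parcs (cycle_graph n)"
      by (auto simp: cycle_graph_def)
    with Suc show ?case
      by (metis Suc_lessD reachable_adj_trans with_proj_simps(3))
  qed
  have "i \<rightarrow>\<^sup>*\<^bsub>with_proj (cycle_graph n)\<^esub> j" if "i < n" "j < n" for i j
    using from0[OF that(1)] from0[OF that(2)] symmetric_reachable[OF sym_arcs]
    by (metis reachable_trans)
  then show ?thesis
    using assms by (auto simp: strongly_connected_def V)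
qed

lemma pair_graph_strong_product:
  assumes "pair_graph G" "pair_graph H"
  shows "pair_graph (G \<boxtimes> H)"
proof -
  interpret G: pair_graph G by fact
  interpret H: pair_graph H by fact
  have "finite (parcs (G \<boxtimes> H))"
    by (rule finite_subset[of _ "(pverts G \<times> pverts H) \<times> (pverts G \<times> pverts H)"])
      (auto simp: strong_product_def G.pair_finite_verts H.pair_finite_verts
         dest: G.wellformed' H.wellformed')
  moreover have "sym (parcs (G \<boxtimes> H))"
    by (rule symI)
      (auto simp: strong_product_def dest: G.arcs_symmetric H.arcs_symmetric)
  ultimately show ?thesis
    by unfold_locales
      (auto simp: strong_product_def symmetric_def G.pair_finite_verts H.pair_finite_verts
         dest: G.wellformed' H.wellformed' G.no_loops' H.no_loops')
qed

lemma strongly_connected_strong_product: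
  assumes "pair_graph G" "pair_graph H"
    and "strongly_connected (with_proj G)" "strongly_connected (with_proj H)"
  shows "strongly_connected (with_proj (G \<boxtimes> H))"
proof -
  interpret G: pair_graph G by fact
  interpret H: pair_graph H by fact
  interpret P: pair_graph "G \<boxtimes> H"
    by (rule pair_graph_strong_product) fact+
  have V: "pverts (G \<boxtimes> H) = pverts G \<times> pverts H"
    by (simp add: strong_product_def)
  have left: "(a, y) \<rightarrow>\<^sup>*\<^bsub>with_proj (G \<boxtimes> H)\<^esub> (b, y)"
    if "a \<rightarrow>\<^sup>*\<^bsub>with_proj G\<^esub> b" "y \<in> pverts H" for a b y
    using that(1)
  proof (induction rule: G.reachable_induct)
    case base
    then show ?case using that(2) by (simp add: V)
  next
    case (step b c)
    then have "((b, y), (c, y)) \<in> parcs (G \<boxtimes> H)"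
      using that(2) by (auto simp: strong_product_def)
    with step show ?case
      by (metis P.reachable_adj_trans with_proj_simps(3))
  qed
  have right: "(x, a) \<rightarrow>\<^sup>*\<^bsub>with_proj (G \<boxtimes> H)\<^esub> (x, b)"
    if "a \<rightarrow>\<^sup>*\<^bsub>with_proj H\<^esub> b" "x \<in> pverts G" for a b x
    using that(1)
  proof (induction rule: H.reachable_induct)
    case base
    then show ?case using that(2) by (simp add: V)
  next
    case (step b c)
    then have "((x, b), (x, c)) \<in> parcs (G \<boxtimes> H)"
      using that(2) by (auto simp: strong_product_def)
    with step show ?case
      by (metis P.reachable_adj_trans with_proj_simps(3))
  qed
  show ?thesis
    unfolding strongly_connected_def
  proof (intro conjI ballI)
    show "verts (with_proj (G \<boxtimes> H)) \<noteq> {}"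
      using assms(3,4) by (auto simp: strongly_connected_def V)
  next
    fix u v
    assume "u \<in> verts (with_proj (G \<boxtimes> H))" "v \<in> verts (with_proj (G \<boxtimes> H))"
    then obtain a b c d where uv: "u = (a, b)" "v = (c, d)"
      and V': "a \<in> pverts G" "c \<in> pverts G" "b \<in> pverts H" "d \<in> pverts H"
      by (auto simp: V)
    have "(a, b) \<rightarrow>\<^sup>*\<^bsub>with_proj (G \<boxtimes> H)\<^esub> (c, b)"
      using assms(3) V' by (intro left) (simp_all add: strongly_connected_def)
    moreover have "(c, b) \<rightarrow>\<^sup>*\<^bsub>with_proj (G \<boxtimes> H)\<^esub> (c, d)"
      using assms(4) V' by (intro right) (simp_all add: strongly_connected_def)
    ultimately show "u \<rightarrow>\<^sup>*\<^bsub>with_proj (G \<boxtimes> H)\<^esub> v"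
      unfolding uv by (rule P.reachable_trans)
  qed
qed

lemma general_position_set_iff_gdist:
  assumes "pair_graph G" "strongly_connected (with_proj G)"
  shows "general_position_set G S \<longleftrightarrow>
     S \<subseteq> pverts G \<and>
     (\<forall>u\<in>S. \<forall>v\<in>S. \<forall>w\<in>S. u \<noteq> v \<longrightarrow> w \<noteq> u \<longrightarrow> w \<noteq> v \<longrightarrow>
        gdist G u v \<noteq> gdist G u w + gdist G w v)"
proof -
  interpret pair_graph G by fact
  have cost: "awalk_cost (\<lambda>_. 1) p = real (length p)" for p
    by (induction p) auto
  have le: "gdist G u v \<le> ereal (real (length p))" if "awalk u p v" for u v p
    using min_cost_le_walk_cost[OF that, of "\<lambda>_. 1"] by (simp add: gdist_def cost)
  have ex: "\<exists>p. apath u p v \<and> gdist G u v = ereal (real (length p))"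
    if "u \<in> pverts G" "v \<in> pverts G" for u v
  proof -
    have "u \<rightarrow>\<^sup>*\<^bsub>with_proj G\<^esub> v"
      using assms(2) that by (auto simp: strongly_connected_def)
    from no_neg_cyc_reach_imp_path[OF this, of "\<lambda>_. 1"] show ?thesis
      by (auto simp: gdist_def cost)
  qed
  have "(\<exists>p. shortest_path G u p v \<and> w \<in> set (pawalk_verts u p)) \<longleftrightarrow>
      gdist G u v = gdist G u w + gdist G w v"
    if V: "u \<in> pverts G" "v \<in> pverts G" "w \<in> pverts G" for u v w
  proof
    assume "\<exists>p. shortest_path G u p v \<and> w \<in> set (pawalk_verts u p)"
    then obtain p where p: "apath u p v" "ereal (real (length p)) = gdist G u v"
      "w \<in> set (pawalk_verts u p)"
      by (auto simp: shortest_path_def)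
    then obtain q r where qr: "p = q @ r" "awalk u q w" "awalk w r v"
      using awalk_decomp[of u p v w] by (auto simp: apath_def)
    obtain q' where q': "awalk u q' w" "gdist G u w = ereal (real (length q'))"
      using ex[of u w] V by (auto simp: apath_def)
    obtain r' where r': "awalk w r' v" "gdist G w v = ereal (real (length r'))"
      using ex[of w v] V by (auto simp: apath_def)
    have "awalk u (q' @ r') v"
      using q' r' by (auto intro: awalk_appendI)
    from le[OF this] le[OF qr(2)] le[OF qr(3)] show "gdist G u v = gdist G u w + gdist G w v"
      using p(2) q'(2) r'(2) qr(1) by (simp flip: p(2))
  next
    assume eq: "gdist G u v = gdist G u w + gdist G w v"
    obtain q where q: "awalk u q w" "gdist G u w = ereal (real (length q))"
      using ex[of u w] V by (auto simp: apath_def)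
    obtain r where r: "awalk w r v" "gdist G w v = ereal (real (length r))"
      using ex[of w v] V by (auto simp: apath_def)
    have qr: "awalk u (q @ r) v"
      using q r by (auto intro: awalk_appendI)
    have len: "ereal (real (length (q @ r))) = gdist G u v"
      using eq q r by simp
    have "apath u (q @ r) v"
    proof (rule ccontr)
      assume "\<not> apath u (q @ r) v"
      then have "\<not> distinct (pawalk_verts u (q @ r))"
        using qr by (simp add: apath_def)
      then obtain a b c where d: "is_awalk_cyc_decomp (q @ r) (a, b, c)"
        using awalk_cyc_decomp_has_prop[OF qr] by (metis prod_cases3)
      then have abc: "q @ r = a @ b @ c" "b \<noteq> []"
        by auto
      obtain x where "awalk u (a @ c) v"
        using d qr by (auto dest!: awalk_ends_eqD)
      from le[OF this] show False
        using abc len arg_cong[OF abc(1), of length] by (cases b) (auto simp flip: len)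
    qed
    moreover have "w \<in> set (pawalk_verts u (q @ r))"
      using set_awalk_verts_append[OF q(1) r(1)] hd_in_awalk_verts(1)[OF r(1)] by simp
    ultimately show "\<exists>p. shortest_path G u p v \<and> w \<in> set (pawalk_verts u p)"
      using len by (auto simp: shortest_path_def)
  qed
  then show ?thesis
    unfolding general_position_set_def by (meson subsetD)
qed

end

theory Submission
  imports Defs
begin

text \<open>
  In a strong product of two cycles the distance is the larger of the two cyclic distances. Call two
  points an X-pair if the distance in the first factor is strictly larger than the one in the second
  factor, and a Y-pair otherwise. Points that pairwise form X-pairs project to a general position set
  of the first cycle, and points that pairwise form Y-pairs to one of the second cycle; a cycle has
  at most three points in general position, so X-cliques and Y-cliques have at most three points.
  Along an arc of at most half of the second cycle, Y-pairs compose: they form a partial order, and a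
  chain of three points would put the middle one on a shortest path. The points over such an arc
  therefore split into two X-cliques, and there are at most six of them (\<open>half_arc_card_le_6\<close>).

  Covering \<open>C\<^sub>t\<close> by two half arcs bounds the number of points on their overlap, which is one level for odd
  \<open>t\<close> and two consecutive levels for even \<open>t\<close> (\<open>overlap_bound\<close>). Summing over the levels settles
  \<open>t = 8\<close> and gives at most ten points for \<open>t = 7, 9\<close>. For \<open>t = 3, 6\<close> three complements of half arcs
  partition the cycle, and each of them holds all but at most six of the points. Ten points for \<open>t = 10\<close>, or
  eleven for \<open>t = 11\<close>, make all these estimates sharp, with the same number of points on each level or,
  possibly for \<open>t = 10\<close>, two points on every second level. Then every half arc consists of two full
  X-triples, a triple determines how far the coordinate in \<open>C\<^sub>7\<close> turns from one level to the next, this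
  turn is the same at all levels, and it does not close up modulo 7 (\<open>no_winding\<close>). For \<open>t = 5\<close> the
  same analysis is applied with the two factors exchanged: the seven levels over \<open>C\<^sub>7\<close> must carry
  \<open>1, 2, 1, 2, 1, 2, 1\<close> points, all single points share one coordinate in \<open>C\<^sub>5\<close>, and three of them lie on
  a common geodesic.

  Let \<open>t \<ge> 12\<close> and suppose that there are ten points. A Y-pair whose levels are \<open>s\<close> apart forces at least
  seven points onto the \<open>s + 5\<close> levels around it (\<open>ypair_neighbourhood\<close>): all other points lie almost
  opposite to the pair, where they form an X-clique. Half arcs hold six points, so no Y-pair is short.
  On the other hand being equal or an X-pair cannot be transitive, since otherwise there would be at
  most three classes with at most three points each (\<open>xpairs_not_transitive\<close>); hence some Y-pair has
  \<open>s \<le> 4\<close>. This is a contradiction for \<open>t \<ge> 16\<close>. For \<open>t = 12, \<dots>, 15\<close> the same facts restrict the numbers of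
  points per level so much that no profile remains for \<open>t = 12, 15\<close>, while for \<open>t = 13, 14\<close> the remaining
  profiles arrange the occupied levels essentially in a cycle of length seven, on which the
  coordinates in \<open>C\<^sub>7\<close> again do not close up (\<open>no_seven_cycle\<close>, \<open>no_block_of_four\<close>).

  Nine points are obtained from three levels that are almost equally spaced, with three points on
  each of them; small \<open>t\<close> and the three exceptional values have explicit witnesses.
\<close>

section \<open>Distance in a cycle\<close>

text \<open>
  The distance of \<open>a\<close> from \<open>0\<close> in the cycle on the residues modulo \<open>m\<close>. Distances between vertices are
  norms of differences of integer representatives.
\<close>
definition cyc_norm :: "int \<Rightarrow> int \<Rightarrow> int" where
  "cyc_norm m a = min (a mod m) ((- a) mod m)"

lemma cyc_norm_nonneg: "m > 0 \<Longrightarrow> 0 \<le> cyc_norm m a"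
  by (simp add: cyc_norm_def)

lemma cyc_norm_minus [simp]: "cyc_norm m (- a) = cyc_norm m a"
  by (simp add: cyc_norm_def min.commute)

lemma cyc_norm_diff_commute: "cyc_norm m (a - b) = cyc_norm m (b - a)"
  using cyc_norm_minus[of m "a - b"] by simp

lemma cyc_norm_cong: "a mod m = b mod m \<Longrightarrow> cyc_norm m a = cyc_norm m b"
  unfolding cyc_norm_def by (metis mod_minus_cong)

lemma cyc_norm_cases:
  assumes "m > 0"
  obtains "cyc_norm m a = a mod m" "2 * (a mod m) \<le> m"
    | "cyc_norm m a = m - a mod m" "m \<le> 2 * (a mod m)"
proof (cases "a mod m = 0")
  case True
  then show ?thesis using assms that by (simp add: cyc_norm_def zmod_zminus1_eq_if)
next
  case False
  moreover have "0 \<le> a mod m" "a mod m < m" using assms by auto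
  ultimately show ?thesis
    using assms that by (cases "2 * (a mod m) \<le> m") (auto simp: cyc_norm_def zmod_zminus1_eq_if)
qed

lemma cyc_norm_le_half: "m > 0 \<Longrightarrow> 2 * cyc_norm m a \<le> m"
  by (rule cyc_norm_cases[of m a]) auto

lemma cyc_norm_eq_0_iff: "m > 0 \<Longrightarrow> cyc_norm m a = 0 \<longleftrightarrow> m dvd a"
  by (rule cyc_norm_cases[of m a])
    (auto simp: dvd_eq_mod_eq_0 dest: pos_mod_bound[of m a])

lemma cyc_norm_small:
  assumes "m > 0" "2 * \<bar>a\<bar> \<le> m"
  shows "cyc_norm m a = \<bar>a\<bar>"
proof -
  have *: "cyc_norm m b = b" if "0 \<le> b" "2 * b \<le> m" for b
  proof -
    have "b mod m = b" using that assms(1) by (intro mod_pos_pos_trivial) auto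
    then show ?thesis using that assms(1) by (auto simp: cyc_norm_def zmod_zminus1_eq_if)
  qed
  show ?thesis
  proof (cases "a \<ge> 0")
    case True
    then show ?thesis using assms *[of a] by simp
  next
    case False
    then show ?thesis using assms *[of "- a"] by simp
  qed
qed

lemma cyc_norm_large:
  assumes "m > 0" "m \<le> 2 * a" "a \<le> m"
  shows "cyc_norm m a = m - a"
proof -
  have "cyc_norm m (a - m) = \<bar>a - m\<bar>" using assms by (intro cyc_norm_small) auto
  moreover have "cyc_norm m (a - m) = cyc_norm m a" by (rule cyc_norm_cong) simp
  ultimately show ?thesis using assms by simp
qed

lemma cyc_norm_le_abs: "m > 0 \<Longrightarrow> cyc_norm m a \<le> \<bar>a\<bar>"
proof -
  assume m: "m > 0"
  show ?thesis
  proof (cases "2 * \<bar>a\<bar> \<le> m")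
    case True
    then show ?thesis using m by (simp add: cyc_norm_small)
  next
    case False
    then show ?thesis using cyc_norm_le_half[OF m, of a] by linarith
  qed
qed

text \<open>
  Together with \<open>cyc_norm_le_abs\<close> this says that the norm is the least absolute value in the residue
  class of \<open>a\<close>, which is the reason for the triangle inequality.
\<close>
lemma cyc_norm_attained:
  assumes "m > 0"
  obtains k where "cyc_norm m a = \<bar>a - k * m\<bar>"
proof (rule cyc_norm_cases[OF assms, of a])
  assume "cyc_norm m a = a mod m"
  then have "cyc_norm m a = \<bar>a - (a div m) * m\<bar>"
    using assms by (simp add: minus_div_mult_eq_mod)
  then show thesis by (rule that)
next
  assume "cyc_norm m a = m - a mod m"
  moreover have "a - (a div m + 1) * m = a mod m - m"
    by (simp add: algebra_simps minus_div_mult_eq_mod[symmetric])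
  moreover have "a mod m < m" using assms by simp
  ultimately have "cyc_norm m a = \<bar>a - (a div m + 1) * m\<bar>" by simp
  then show thesis by (rule that)
qed

lemma cyc_norm_triangle:
  assumes "m > 0"
  shows "cyc_norm m (a + b) \<le> cyc_norm m a + cyc_norm m b"
proof -
  obtain k where k: "cyc_norm m a = \<bar>a - k * m\<bar>" using assms by (rule cyc_norm_attained)
  obtain l where l: "cyc_norm m b = \<bar>b - l * m\<bar>" using assms by (rule cyc_norm_attained)
  have "cyc_norm m (a + b) = cyc_norm m (a + b - (k + l) * m)"
    by (rule cyc_norm_cong) (simp add: mod_diff_right_eq[symmetric])
  also have "\<dots> \<le> \<bar>a + b - (k + l) * m\<bar>" using assms by (rule cyc_norm_le_abs)
  finally show ?thesis using k l by (simp add: algebra_simps)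
qed

text \<open>
  One step of a geodesic towards \<open>0\<close>.
\<close>
lemma cyc_norm_step:
  assumes "m > 0" "cyc_norm m a > 0"
  obtains e where "e = 1 \<or> e = - 1" "cyc_norm m (a + e) = cyc_norm m a - 1"
proof -
  obtain k where k: "cyc_norm m a = \<bar>a - k * m\<bar>" using assms(1) by (rule cyc_norm_attained)
  \<comment> \<open>Move towards the nearest multiple of \<open>m\<close>.\<close>
  define e :: int where "e = (if a - k * m > 0 then - 1 else 1)"
  have ab: "\<bar>a - k * m + e\<bar> = cyc_norm m a - 1"
    using k assms(2) by (auto simp: e_def)
  have "cyc_norm m (a + e) = cyc_norm m (a + e - k * m)"
    by (rule cyc_norm_cong) (simp add: mod_diff_right_eq[symmetric])
  also have "\<dots> = cyc_norm m (a - k * m + e)" by (simp add: algebra_simps)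
  also have "\<dots> = cyc_norm m a - 1"
    using cyc_norm_small[OF assms(1), of "a - k * m + e"] cyc_norm_le_half[OF assms(1), of a]
    unfolding ab by simp
  finally show thesis using that[of e] by (auto simp: e_def split: if_splits)
qed

section \<open>Cliques and half arcs\<close>

lemma four_elements_increasing:
  fixes R :: "'a :: linorder set"
  assumes "card R \<ge> 4"
  obtains a b c d where "a \<in> R" "b \<in> R" "c \<in> R" "d \<in> R" "a < b" "b < c" "c < d"
proof -
  define xs where "xs = sorted_list_of_set R"
  have fin: "finite R" using assms card_ge_0_finite by force
  have xs: "set xs = R" "length xs = card R" "sorted_wrt (<) xs"
    using fin by (simp_all add: xs_def)
  have lt: "xs ! i < xs ! j" if "i < j" "j < 4" for i j
    using sorted_wrt_nth_less[OF xs(3) that(1)] that xs(2) assms by simp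
  have mem: "xs ! i \<in> R" if "i < 4" for i
    using that xs assms nth_mem[of i xs] by simp
  show thesis
    using that[of "xs ! 0" "xs ! 1" "xs ! 2" "xs ! 3"] lt mem by simp
qed

text \<open>
  A finite set in general position in the strong product of the cycles on \<open>m\<close> and \<open>n\<close> vertices. The
  points are abstract and carry integer representatives of their coordinates, so that the factors
  can be exchanged by exchanging \<open>X\<close> and \<open>Y\<close>, and levels, i.e. values of \<open>Y\<close>, can be counted from any
  base level without reducing modulo \<open>n\<close>.
\<close>
locale gp_torus =
  fixes m n :: int and S :: "'a set" and X Y :: "'a \<Rightarrow> int"
  assumes m3: "m \<ge> 3" and n3: "n \<ge> 3" and fin: "finite S"
    and sep: "\<And>p q. p \<in> S \<Longrightarrow> q \<in> S \<Longrightarrow> p \<noteq> q \<Longrightarrow>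
        cyc_norm m (X p - X q) \<noteq> 0 \<or> cyc_norm n (Y p - Y q) \<noteq> 0"
    and gp: "\<And>p q r. p \<in> S \<Longrightarrow> q \<in> S \<Longrightarrow> r \<in> S \<Longrightarrow> p \<noteq> q \<Longrightarrow> r \<noteq> p \<Longrightarrow> r \<noteq> q \<Longrightarrow>
        max (cyc_norm m (X p - X q)) (cyc_norm n (Y p - Y q)) \<noteq>
        max (cyc_norm m (X p - X r)) (cyc_norm n (Y p - Y r)) +
        max (cyc_norm m (X r - X q)) (cyc_norm n (Y r - Y q))"
begin

lemma m_pos: "m > 0" and n_pos: "n > 0"
  using m3 n3 by auto

lemma swapped: "gp_torus n m S Y X"
proof unfold_locales
  fix p q r
  show "cyc_norm n (Y p - Y q) \<noteq> 0 \<or> cyc_norm m (X p - X q) \<noteq> 0"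
    if "p \<in> S" "q \<in> S" "p \<noteq> q"
    using sep[OF that] by blast
  show "max (cyc_norm n (Y p - Y q)) (cyc_norm m (X p - X q)) \<noteq>
      max (cyc_norm n (Y p - Y r)) (cyc_norm m (X p - X r)) +
      max (cyc_norm n (Y r - Y q)) (cyc_norm m (X r - X q))"
    if "p \<in> S" "q \<in> S" "r \<in> S" "p \<noteq> q" "r \<noteq> p" "r \<noteq> q"
    using gp[OF that] by (simp only: max.commute[of "cyc_norm n _"] not_False_eq_True)
qed (use m3 n3 fin in auto)

lemma subset: "T \<subseteq> S \<Longrightarrow> gp_torus m n T X Y"
  using m3 n3 fin sep gp
  by unfold_locales (auto simp: subset_iff intro: finite_subset)

definition dX :: "'a \<Rightarrow> 'a \<Rightarrow> int" where "dX p q = cyc_norm m (X p - X q)"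
definition dY :: "'a \<Rightarrow> 'a \<Rightarrow> int" where "dY p q = cyc_norm n (Y p - Y q)"

lemma d_self [simp]: "dX p p = 0" "dY p p = 0"
  by (simp_all add: dX_def dY_def cyc_norm_def)

lemma d_commute: "dX p q = dX q p" "dY p q = dY q p"
  unfolding dX_def dY_def by (rule cyc_norm_diff_commute)+

lemma d_nonneg: "dX p q \<ge> 0" "dY p q \<ge> 0"
  unfolding dX_def dY_def using m_pos n_pos by (simp_all add: cyc_norm_nonneg)

lemma d_le_half: "2 * dX p q \<le> m" "2 * dY p q \<le> n"
  unfolding dX_def dY_def using m_pos n_pos by (simp_all add: cyc_norm_le_half)

lemma dX_triangle: "dX p r \<le> dX p q + dX q r"
  using cyc_norm_triangle[OF m_pos, of "X p - X q" "X q - X r"] by (simp add: dX_def)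

lemma no_between:
  "p \<in> S \<Longrightarrow> q \<in> S \<Longrightarrow> r \<in> S \<Longrightarrow> p \<noteq> q \<Longrightarrow> r \<noteq> p \<Longrightarrow> r \<noteq> q \<Longrightarrow>
     max (dX p q) (dY p q) \<noteq> max (dX p r) (dY p r) + max (dX r q) (dY r q)"
  unfolding dX_def dY_def by (rule gp)

lemma separated: "p \<in> S \<Longrightarrow> q \<in> S \<Longrightarrow> p \<noteq> q \<Longrightarrow> dX p q \<noteq> 0 \<or> dY p q \<noteq> 0"
  unfolding dX_def dY_def by (rule sep)

text \<open>
  On such a set the distance is the one of the first coordinates, which are distinct. Of four
  vertices of a cycle, taken in cyclic order, either the first and the third are joined by a geodesic
  through the second, or by one through the fourth.
\<close>
lemma weak_xclique_card_le_3:
  assumes "A \<subseteq> S" and le: "\<And>p q. p \<in> A \<Longrightarrow> q \<in> A \<Longrightarrow> p \<noteq> q \<Longrightarrow> dY p q \<le> dX p q"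
  shows "card A \<le> 3"
proof (rule ccontr)
  assume "\<not> card A \<le> 3"
  define r where "r p = X p mod m" for p
  have dX_r: "dX p q = cyc_norm m (r p - r q)" for p q
    unfolding dX_def r_def by (rule cyc_norm_cong) (simp add: mod_diff_eq)
  have "inj_on r A"
  proof (rule inj_onI, rule ccontr)
    fix p q assume pq: "p \<in> A" "q \<in> A" "r p = r q" "p \<noteq> q"
    then have "dX p q = 0" by (simp add: dX_r cyc_norm_def)
    with pq le[of p q] separated[of p q] d_nonneg[of p q] assms(1) show False
      by (auto simp: subset_iff)
  qed
  then have "card (r ` A) \<ge> 4"
    using \<open>\<not> card A \<le> 3\<close> by (simp add: card_image)
  then obtain a b c d where R: "a \<in> r ` A" "b \<in> r ` A" "c \<in> r ` A" "d \<in> r ` A"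
    and lt: "a < b" "b < c" "c < d"
    by (rule four_elements_increasing)
  obtain p q u v where p: "p \<in> A" "r p = a" and q: "q \<in> A" "r q = b"
    and u: "u \<in> A" "r u = c" and v: "v \<in> A" "r v = d"
    using R by blast
  have bounds: "0 \<le> a" "d < m" using p v m_pos by (auto simp: r_def)
  have d: "max (dX x y) (dY x y) = dX x y" if "x \<in> A" "y \<in> A" "x \<noteq> y" for x y
    using le[OF that] by simp
  have nb: "dX x y \<noteq> dX x z + dX z y"
    if "x \<in> A" "y \<in> A" "z \<in> A" "x \<noteq> y" "z \<noteq> x" "z \<noteq> y" for x y z
    using no_between[of x y z] d[of x y] d[of x z] d[of z y] that assms(1) by auto
  have ne: "p \<noteq> u" "p \<noteq> q" "q \<noteq> u" "v \<noteq> p" "v \<noteq> u"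
    using p q u v lt by auto
  show False
  proof (cases "2 * (c - a) \<le> m")
    case True
    have "dX p u = c - a" "dX p q = b - a" "dX q u = c - b"
      using True lt bounds m_pos cyc_norm_small[of m "a - c"] cyc_norm_small[of m "a - b"]
        cyc_norm_small[of m "b - c"] by (simp_all add: dX_r p q u)
    moreover have "dX p u \<noteq> dX p q + dX q u"
      using nb[of p u q] p q u ne by auto
    ultimately show False by simp
  next
    case False
    have "dX p u = m - (c - a)" "dX u v = d - c" "dX v p = m - (d - a)"
      using False lt bounds m_pos cyc_norm_large[of m "c - a"] cyc_norm_small[of m "c - d"]
        cyc_norm_large[of m "d - a"] cyc_norm_diff_commute[of m a c]
      by (simp_all add: dX_r p u v)
    moreover have "dX p u \<noteq> dX p v + dX v u"
      using nb[of p u v] p u v ne by auto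
    ultimately show False by (simp add: d_commute)
  qed
qed

definition xclique :: "'a set \<Rightarrow> bool" where
  "xclique A \<longleftrightarrow> A \<subseteq> S \<and> (\<forall>p\<in>A. \<forall>q\<in>A. p \<noteq> q \<longrightarrow> dY p q < dX p q)"

lemma xcliqueD: "xclique A \<Longrightarrow> p \<in> A \<Longrightarrow> q \<in> A \<Longrightarrow> p \<noteq> q \<Longrightarrow> dY p q < dX p q"
  by (simp add: xclique_def)

lemma xclique_card_le_3: "xclique A \<Longrightarrow> card A \<le> 3"
  by (rule weak_xclique_card_le_3) (auto simp: xclique_def less_imp_le)

lemma yclique_card_le_3:
  assumes "A \<subseteq> S" and le: "\<And>p q. p \<in> A \<Longrightarrow> q \<in> A \<Longrightarrow> p \<noteq> q \<Longrightarrow> dX p q \<le> dY p q"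
  shows "card A \<le> 3"
proof -
  interpret sw: gp_torus n m S Y X by (rule swapped)
  show ?thesis
    by (rule sw.weak_xclique_card_le_3)
      (use assms in \<open>auto simp: sw.dX_def sw.dY_def dX_def dY_def\<close>)
qed

text \<open>
  Two consecutive Y-pairs in the same direction span a geodesic as long as they do not go further
  than half around the second cycle.
\<close>
lemma no_chain:
  assumes S: "p \<in> S" "q \<in> S" "r \<in> S"
    and i: "(Y q - Y p) mod n = i mod n" "0 < i" "dX p q \<le> i"
    and j: "(Y r - Y q) mod n = j mod n" "0 < j" "dX q r \<le> j"
    and half: "2 * (i + j) \<le> n"
  shows False
proof -
  have ij: "(Y r - Y p) mod n = (i + j) mod n"
    using mod_add_cong[OF i(1) j(1)] by (simp add: add.commute)
  have "dY p q = i" "dY q r = j" "dY p r = i + j"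
    using cyc_norm_cong[OF i(1)] cyc_norm_cong[OF j(1)] cyc_norm_cong[OF ij] i(2) j(2) half
      cyc_norm_small[OF n_pos, of i] cyc_norm_small[OF n_pos, of j] cyc_norm_small[OF n_pos, of "i + j"]
      d_commute(2)[of p q] d_commute(2)[of q r] d_commute(2)[of p r]
    by (simp_all add: dY_def)
  moreover from this have "p \<noteq> q" "q \<noteq> r" "p \<noteq> r"
    using i(2) j(2) by auto
  moreover have "dX p r \<le> i + j" using dX_triangle[of p r q] i(3) j(3) by simp
  ultimately show False
    using no_between[of p r q] S i(3) j(3) by auto
qed

text \<open>
  The points on the \<open>k\<close> consecutive levels that start at level \<open>y\<close>.
\<close>
definition arc :: "int \<Rightarrow> int \<Rightarrow> 'a set" where
  "arc y k = {p \<in> S. (Y p - y) mod n < k}"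

lemma arc_subset: "arc y k \<subseteq> S" by (auto simp: arc_def)

lemma finite_arc [simp]: "finite (arc y k)"
  using fin arc_subset finite_subset by blast

lemma dY_in_arc:
  assumes "p \<in> arc y k" "q \<in> arc y k" "2 * (k - 1) \<le> n"
  shows "dY p q = \<bar>(Y p - y) mod n - (Y q - y) mod n\<bar>"
proof -
  have "dY p q = cyc_norm n ((Y p - y) mod n - (Y q - y) mod n)"
    unfolding dY_def by (rule cyc_norm_cong) (simp add: mod_diff_eq)
  also have "\<dots> = \<bar>(Y p - y) mod n - (Y q - y) mod n\<bar>"
  proof (rule cyc_norm_small[OF n_pos])
    have "0 \<le> (Y p - y) mod n" "0 \<le> (Y q - y) mod n" using n_pos by simp_all
    moreover have "(Y p - y) mod n < k" "(Y q - y) mod n < k" using assms by (auto simp: arc_def)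
    moreover have "2 * \<bar>a - b\<bar> \<le> n" if "0 \<le> a" "0 \<le> b" "a < k" "b < k" for a b
      using that assms(3) by (cases "a \<le> b") auto
    ultimately show "2 * \<bar>(Y p - y) mod n - (Y q - y) mod n\<bar> \<le> n" by blast
  qed
  finally show ?thesis .
qed

text \<open>
  On a half arc the Y-pairs, directed upwards, form a relation \<open>below\<close> without chains of length three.
  Its minimal elements and the remaining elements are therefore two antichains, and two incomparable
  points form an X-pair.
\<close>
lemma half_arc_split:
  assumes "2 * (k - 1) \<le> n"
  obtains T U where "arc y k = T \<union> U" "T \<inter> U = {}" "xclique T" "xclique U"
proof -
  define pos where "pos p = (Y p - y) mod n" for p
  define below where "below p q \<longleftrightarrow> pos p < pos q \<and> dX p q \<le> pos q - pos p" for p q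
  define T where "T = {q \<in> arc y k. \<forall>p\<in>arc y k. \<not> below p q}"
  have dYp: "dY p q = \<bar>pos p - pos q\<bar>" if "p \<in> arc y k" "q \<in> arc y k" for p q
    using dY_in_arc[OF that assms] by (simp add: pos_def)
  have xpair: "dY p q < dX p q"
    if "p \<in> arc y k" "q \<in> arc y k" "p \<noteq> q" "\<not> below p q" "\<not> below q p" for p q
  proof (cases "pos p = pos q")
    case True
    then show ?thesis
      using dYp[OF that(1,2)] separated[of p q] d_nonneg[of p q] that arc_subset by fastforce
  next
    case False
    then show ?thesis
      using dYp[OF that(1,2)] that(4,5) d_commute[of p q] by (auto simp: below_def)
  qed
  have chain: False if "p \<in> arc y k" "q \<in> arc y k" "r \<in> arc y k" "below p q" "below q r" for p q r
  proof -
    have m: "(Y b - Y a) mod n = (pos b - pos a) mod n" for a b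
      by (simp add: pos_def mod_diff_eq)
    have "pos r < k" "pos p \<ge> 0" using that n_pos by (auto simp: arc_def pos_def)
    then show False
      using that arc_subset assms
      by (intro no_chain[of p q r "pos q - pos p" "pos r - pos q"] m) (auto simp: below_def)
  qed
  show thesis
  proof (rule that)
    show "arc y k = T \<union> (arc y k - T)" by (auto simp: T_def)
    show "xclique T"
      unfolding xclique_def using xpair by (auto simp: T_def arc_def)
    show "xclique (arc y k - T)"
      unfolding xclique_def
    proof (intro conjI ballI impI)
      fix p q assume pq: "p \<in> arc y k - T" "q \<in> arc y k - T" "p \<noteq> q"
      then have "\<not> below p q" "\<not> below q p" using chain by (auto simp: T_def)
      then show "dY p q < dX p q" using xpair pq by blast
    qed (auto simp: arc_def)
  qed auto
qed

lemma half_arc_card_le_6: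
  assumes "2 * (k - 1) \<le> n"
  shows "card (arc y k) \<le> 6"
proof -
  obtain T U where "arc y k = T \<union> U" "xclique T" "xclique U"
    using half_arc_split[OF assms, of y] .
  then show ?thesis
    using card_Un_le[of T U] xclique_card_le_3[of T] xclique_card_le_3[of U] by simp
qed

lemma full_half_arc_split:
  assumes "2 * (k - 1) \<le> n" "card (arc y k) = 6"
  obtains T U where "arc y k = T \<union> U" "T \<inter> U = {}" "xclique T" "xclique U" "card T = 3" "card U = 3"
proof -
  obtain T U where *: "arc y k = T \<union> U" "T \<inter> U = {}" "xclique T" "xclique U"
    using half_arc_split[OF assms(1), of y] .
  then have "finite T" "finite U" by (metis finite_Un finite_arc)+
  then have "card T + card U = 6" using * assms(2) by (metis card_Un_disjoint)
  then show thesis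
    using that[OF *] xclique_card_le_3[OF *(3)] xclique_card_le_3[OF *(4)] by simp
qed

end

section \<open>Residues modulo 7\<close>

lemma cyc_norm_7: "cyc_norm 7 z = (if z mod 7 \<le> 3 then z mod 7 else 7 - z mod 7)"
  using pos_mod_bound[of 7 z] by (auto simp: cyc_norm_def zmod_zminus1_eq_if)

lemma residue_7_cases:
  fixes z :: int
  obtains "z mod 7 = 0" | "z mod 7 = 1" | "z mod 7 = 2" | "z mod 7 = 3" | "z mod 7 = 4"
    | "z mod 7 = 5" | "z mod 7 = 6"
proof -
  have "0 \<le> z mod 7" "z mod 7 < 7" by simp_all
  then show thesis using that by linarith
qed

text \<open>
  Three vertices of \<open>C\<^sub>7\<close> whose distances are at least 2, at least 2 and 3 divide the cycle into
  arcs of lengths 2, 2 and 3.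
\<close>
lemma equal_turns_mod_7:
  assumes "cyc_norm 7 z > 1" "cyc_norm 7 w > 1" "cyc_norm 7 (z + w) > 2"
  shows "z mod 7 = w mod 7"
  using assms unfolding cyc_norm_7 mod_add_eq[of z 7 w, symmetric]
  by (cases z rule: residue_7_cases; cases w rule: residue_7_cases; simp)

text \<open>
  Vertices with a common vertex \<open>e\<close> at distance 3 are neighbours, and \<open>e\<close> is opposite to the edge
  between them, hence determined by their sum. As 4 is the inverse of 2 modulo 7, the formula
  \<open>4 * (a + b)\<close> is the midpoint of the two vertices along the longer arc.
\<close>
lemma equidistant_pair_mod_7:
  assumes "cyc_norm 7 (a - e) > 2" "cyc_norm 7 (b - e) > 2" "cyc_norm 7 (a - b) > 0"
  shows "e mod 7 = (4 * (a + b)) mod 7"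
proof -
  define z w where "z = a - e" and "w = b - e"
  have ab: "a - b = z - w" by (simp add: z_def w_def)
  have "(4 * (z + w)) mod 7 = 0"
    using assms unfolding ab z_def[symmetric] w_def[symmetric]
      cyc_norm_7 mod_diff_eq[of z 7 w, symmetric] mod_add_eq[of z 7 w, symmetric]
      mod_mult_right_eq[of 4 "z + w", symmetric]
    by (cases z rule: residue_7_cases; cases w rule: residue_7_cases; simp)
  then obtain k where "4 * (z + w) = 7 * k" by (auto elim!: dvdE)
  then have "e - 4 * (a + b) = 7 * (- k - e)" by (simp add: z_def w_def)
  then show ?thesis unfolding mod_eq_dvd_iff by (rule dvdI)
qed

text \<open>
  If \<open>x\<close> and \<open>y\<close> are the opposite vertices of pairs with sums \<open>p\<close> and \<open>q\<close>, then the pair sums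
  \<open>p\<close>, \<open>x + y\<close>, \<open>q\<close> form an arithmetic progression, which is constant only if \<open>x\<close> and \<open>y\<close> coincide.
\<close>
lemma second_difference_mod_7:
  fixes x y p q :: int
  assumes "x mod 7 = (4 * p) mod 7" "y mod 7 = (4 * q) mod 7"
  shows "(q - (x + y)) mod 7 = ((x + y) - p) mod 7"
    and "(x - y) mod 7 \<noteq> 0 \<Longrightarrow> ((x + y) - p) mod 7 \<noteq> 0"
proof -
  have "7 dvd x - 4 * p" "7 dvd y - 4 * q" using assms by (simp_all only: mod_eq_dvd_iff)
  then obtain k l where kl: "x - 4 * p = 7 * k" "y - 4 * q = 7 * l" by (auto elim!: dvdE)
  have "(q - (x + y)) - ((x + y) - p) = 7 * (- (p + q) - 2 * (k + l))" using kl by simp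
  then show "(q - (x + y)) mod 7 = ((x + y) - p) mod 7"
    unfolding mod_eq_dvd_iff by (rule dvdI)
  show "((x + y) - p) mod 7 \<noteq> 0" if "(x - y) mod 7 \<noteq> 0"
  proof
    assume "((x + y) - p) mod 7 = 0"
    then obtain j where "(x + y) - p = 7 * j" by (auto simp: mod_eq_0_iff_dvd elim!: dvdE)
    then have "x - y = 7 * (p + 2 * k - j)" using kl by simp
    with that show False by simp
  qed
qed

text \<open>
  A sequence with constant increments modulo \<open>q\<close> that closes up after a number of steps coprime to \<open>q\<close>
  is constant.
\<close>
lemma no_winding:
  fixes f :: "nat \<Rightarrow> int" and q :: int
  assumes lin: "\<And>i. (f (i + 2) - f (i + 1)) mod q = (f (i + 1) - f i) mod q"
    and per: "f k mod q = f 0 mod q" and cop: "coprime q (int k)"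
  shows "(f 1 - f 0) mod q = 0"
proof -
  define d where "d = f 1 - f 0"
  have step: "(f (Suc i) - f i) mod q = d mod q" for i
    by (induction i) (use lin in \<open>auto simp: d_def\<close>)
  have "(f i - f 0) mod q = (int i * d) mod q" for i
  proof (induction i)
    case (Suc i)
    then have "((f (Suc i) - f i) + (f i - f 0)) mod q = (d + int i * d) mod q"
      using step by (rule mod_add_cong[rotated])
    then show ?case by (simp add: algebra_simps)
  qed simp
  then have "q dvd int k * d"
    using per by (metis dvd_eq_mod_eq_0 mod_eq_dvd_iff)
  then show ?thesis
    using cop by (simp add: coprime_dvd_mult_right_iff d_def dvd_eq_mod_eq_0[symmetric])
qed

section \<open>Numbers of points on levels\<close>

context gp_torus
begin

lemma arc_0 [simp]: "arc y 0 = {}"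
  using n_pos by (auto simp: arc_def not_less)

lemma arc_full [simp]: "arc y n = S"
  using n_pos by (auto simp: arc_def)

lemma arc_cong: assumes "y mod n = y' mod n" shows "arc y k = arc y' k"
  unfolding arc_def mod_diff_cong[OF refl assms] by (rule refl)

lemma arc_add_period [simp]: "arc (y + n) k = arc y k"
  by (rule arc_cong) simp

lemma arc_mono: "k \<le> l \<Longrightarrow> arc y k \<subseteq> arc y l"
  by (auto simp: arc_def)

lemma mem_arc_shift:
  assumes "0 \<le> j" "0 \<le> k" "j + k \<le> n"
  shows "p \<in> arc (y + j) k \<longleftrightarrow> p \<in> S \<and> j \<le> (Y p - y) mod n \<and> (Y p - y) mod n < j + k"
proof -
  define r where "r = (Y p - y) mod n"
  have r: "0 \<le> r" "r < n" using n_pos by (auto simp: r_def)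
  have "(Y p - (y + j)) mod n = (r - j) mod n"
    by (simp add: r_def mod_diff_left_eq algebra_simps)
  also have "\<dots> = (if j \<le> r then r - j else r - j + n)"
  proof (cases "j \<le> r")
    case True
    then show ?thesis using r assms by (auto intro: mod_pos_pos_trivial)
  next
    case False
    then have "(r - j + n) mod n = r - j + n"
      using r assms by (intro mod_pos_pos_trivial) auto
    then show ?thesis using False by simp
  qed
  finally show ?thesis using r assms by (auto simp: arc_def r_def[symmetric])
qed

lemma arc_add:
  assumes "0 \<le> j" "0 \<le> k" "j + k \<le> n"
  shows "arc y (j + k) = arc y j \<union> arc (y + j) k" "arc y j \<inter> arc (y + j) k = {}"
proof -
  have mem: "p \<in> arc y l \<longleftrightarrow> p \<in> S \<and> (Y p - y) mod n < l" for p l by (simp add: arc_def)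
  have *: "(p \<in> arc y (j + k) \<longleftrightarrow> p \<in> arc y j \<or> p \<in> arc (y + j) k) \<and>
      \<not> (p \<in> arc y j \<and> p \<in> arc (y + j) k)" for p
  proof -
    define r where "r = (Y p - y) mod n"
    have "r \<ge> 0" using n_pos by (simp add: r_def)
    then show ?thesis
      unfolding mem_arc_shift[OF assms] mem r_def[symmetric] using assms by auto
  qed
  show "arc y (j + k) = arc y j \<union> arc (y + j) k" "arc y j \<inter> arc (y + j) k = {}"
    using * by blast+
qed

lemma card_arc_add:
  assumes "0 \<le> j" "0 \<le> k" "j + k \<le> n"
  shows "card (arc y (j + k)) = card (arc y j) + card (arc (y + j) k)"
  using arc_add[OF assms, of y] by (simp add: card_Un_disjoint)

lemma arc_2: "arc y 2 = arc y 1 \<union> arc (y + 1) 1"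
  using arc_add(1)[of 1 1 y] n3 by simp

lemma arc_3: "arc y 3 = arc y 1 \<union> arc (y + 1) 1 \<union> arc (y + 2) 1"
  using arc_add(1)[of 2 1 y] arc_2[of y] n3 by simp

definition lev :: "int \<Rightarrow> nat" where "lev k = card (arc k 1)"

lemma lev_cong: "k mod n = l mod n \<Longrightarrow> lev k = lev l"
  by (simp add: lev_def arc_cong[of k l])

lemma card_arc_eq_sum_lev:
  "int k \<le> n \<Longrightarrow> card (arc y (int k)) = (\<Sum>i<k. lev (y + int i))"
proof (induction k)
  case (Suc k)
  then show ?case
    using card_arc_add[of "int k" 1 y] by (simp add: lev_def add.commute)
qed simp

lemma card_eq_sum_lev: "card S = (\<Sum>i<nat n. lev (y + int i))"
  using card_arc_eq_sum_lev[of "nat n" y] n_pos by simp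

abbreviation h :: int where "h \<equiv> n div 2"

lemma h_bounds: "2 * h \<le> n" "n \<le> 2 * h + 1" "h \<ge> 1"
  using n3 by auto

text \<open>
  The half arc ending with the first \<open>2 * h + 2 - n\<close> levels from \<open>y\<close> and the half arc starting at \<open>y\<close>
  have \<open>h + 1\<close> levels each, overlap exactly in these levels, and cover the cycle.
\<close>
lemma overlap_bound: "card S + card (arc y (2 * h + 2 - n)) \<le> 12"
proof -
  define g where "g = 2 * h + 2 - n"
  have g: "0 \<le> g" "g \<le> h + 1" "h + 1 \<le> n" "h + 1 - g = n - (h + 1)" using h_bounds n3 by (auto simp: g_def)
  define b where "b = y + g - (h + 1)"
  have b: "b + (h + 1) = y + g" by (simp add: b_def)
  have "card S = card (arc b (h + 1)) + card (arc (y + g) (n - (h + 1)))"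
    using card_arc_add[of "h + 1" "n - (h + 1)" b] g h_bounds n3 b by simp
  moreover have "card (arc y (h + 1)) = card (arc y g) + card (arc (y + g) (n - (h + 1)))"
    using card_arc_add[of g "n - (h + 1)" y] g by (metis add_diff_cancel_left' diff_add_cancel diff_ge_0_iff_ge add.commute)
  moreover have "card (arc y (h + 1)) \<le> 6" "card (arc b (h + 1)) \<le> 6"
    using h_bounds by (intro half_arc_card_le_6; simp)+
  ultimately show ?thesis by (simp add: g_def)
qed

lemma short_arc_bound: "card S \<le> card (arc y (n - (h + 1))) + 6"
proof -
  have "card S = card (arc (y - (h + 1)) (h + 1)) + card (arc y (n - (h + 1)))"
    using card_arc_add[of "h + 1" "n - (h + 1)" "y - (h + 1)"] h_bounds n3 by simp
  moreover have "card (arc (y - (h + 1)) (h + 1)) \<le> 6"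
    using h_bounds by (intro half_arc_card_le_6) simp
  ultimately show ?thesis by simp
qed

lemma card_le_9_if_3_6: assumes "n = 3 \<or> n = 6" shows "card S \<le> 9"
proof -
  define k where "k = n - (h + 1)"
  have k: "n = k + (k + k)" "k > 0" using assms by (auto simp: k_def)
  have "card (arc 0 (k + (k + k))) = card (arc 0 k) + card (arc (0 + k) (k + k))"
    using k by (intro card_arc_add) auto
  then have "card S = card (arc 0 k) + card (arc (0 + k) (k + k))"
    unfolding k(1)[symmetric] arc_full .
  also have "card (arc (0 + k) (k + k)) = card (arc (0 + k) k) + card (arc (0 + k + k) k)"
    using k by (intro card_arc_add) auto
  finally show ?thesis
    using short_arc_bound[of 0] short_arc_bound[of "0 + k"] short_arc_bound[of "0 + k + k"]
    unfolding k_def[symmetric] by linarith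
qed

lemma card_arc_2: "n \<ge> 2 \<Longrightarrow> card (arc y 2) = lev y + lev (y + 1)"
  using card_arc_add[of 1 1 y] by (simp add: lev_def)

lemma card_le_9_if_8: assumes "n = 8" shows "card S \<le> 9"
proof -
  have "card S + lev y + lev (y + 1) \<le> 12" for y
    using overlap_bound[of y] assms card_arc_2[of y] by simp
  from this[of 0] this[of 2] this[of 4] this[of 6] show ?thesis
    using card_eq_sum_lev[of 0] assms by (simp add: eval_nat_numeral)
qed

lemma odd_lev_bound: assumes "odd n" shows "card S + lev y \<le> 12"
proof -
  have "2 * h + 2 - n = 1" using assms by (elim oddE) simp
  then show ?thesis using overlap_bound[of y] by (simp only: lev_def)
qed

lemma card_le_if_odd: assumes "odd n" shows "int (card S) \<le> n * (12 - int (card S))"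
proof -
  have "card S \<le> 12" using odd_lev_bound[OF assms, of 0] by simp
  have "(\<Sum>i<nat n. lev (0 + int i)) \<le> (\<Sum>i<nat n. 12 - card S)"
  proof (rule sum_mono)
    show "lev (0 + int i) \<le> 12 - card S" for i
      using odd_lev_bound[OF assms, of "0 + int i"] by linarith
  qed
  then have "card S \<le> (\<Sum>i<nat n. 12 - card S)"
    unfolding card_eq_sum_lev[of 0, symmetric] .
  also have "\<dots> = nat n * (12 - card S)" by simp
  finally have "int (card S) \<le> int (nat n * (12 - card S))" by linarith
  then show ?thesis using n_pos \<open>card S \<le> 12\<close> by (simp add: of_nat_diff)
qed

lemma arc_1: assumes "p \<in> arc y 1" shows "(Y p - y) mod n = 0"
proof -
  have "r = 0" if "0 \<le> r" "r < 1" for r :: int using that by simp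
  moreover have "0 \<le> (Y p - y) mod n" using n_pos by simp
  moreover have "(Y p - y) mod n < 1" using assms by (simp add: arc_def)
  ultimately show ?thesis by blast
qed

lemma level_in_arc:
  assumes "p \<in> arc (y + j) 1" "0 \<le> j" "j < k" "k \<le> n"
  shows "p \<in> arc y k"
proof -
  have "p \<in> S \<and> (Y p - y) mod n < j + 1"
    using assms mem_arc_shift[of j 1 p y] by simp
  moreover have "j + 1 \<le> k" using assms by simp
  ultimately show ?thesis unfolding arc_def by (blast intro: less_le_trans)
qed

text \<open>
  If a half arc holds six points, both of its X-cliques are triples. As the levels of an X-pair are
  less than \<open>m div 2\<close> apart, the triple through a point of the first level stays near that level.
\<close>
lemma full_half_arc_first_clique:
  assumes full: "card (arc y (h + 1)) = 6" and p: "p \<in> arc y 1"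
  obtains T where "p \<in> T" "T \<subseteq> arc y (m div 2)" "xclique T" "card T = 3"
    "xclique (arc y (h + 1) - T)" "card (arc y (h + 1) - T) = 3"
proof -
  have half: "2 * (h + 1 - 1) \<le> n" using h_bounds by simp
  note result = that
  have thesis if TU: "arc y (h + 1) = T \<union> U" "T \<inter> U = {}" "xclique T" "xclique U" "card T = 3" "card U = 3"
    and pT: "p \<in> T" for T U
  proof (rule result)
    show "T \<subseteq> arc y (m div 2)"
    proof
      fix q assume q: "q \<in> T"
      have arc: "p \<in> arc y (h + 1)" "q \<in> arc y (h + 1)" using TU pT q by auto
      have p0: "(Y p - y) mod n = 0"
        using p by (rule arc_1)
      have "(Y q - y) mod n < m div 2"
      proof (cases "p = q")
        case True
        then show ?thesis using p0 m3 by auto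
      next
        case False
        then have "dY p q < dX p q" using TU(3) pT q by (auto simp: xclique_def)
        moreover have "dY p q = (Y q - y) mod n"
          using dY_in_arc[OF arc half] p0 n_pos by simp
        ultimately show ?thesis using d_le_half(1)[of p q] by linarith
      qed
      then show "q \<in> arc y (m div 2)" using arc by (auto simp: arc_def)
    qed
    have "arc y (h + 1) - T = U" using TU by auto
    then show "xclique (arc y (h + 1) - T)" "card (arc y (h + 1) - T) = 3" using TU by simp_all
  qed (use TU pT in auto)
  note * = this
  obtain T U where TU: "arc y (h + 1) = T \<union> U" "T \<inter> U = {}" "xclique T" "xclique U"
    "card T = 3" "card U = 3"
    using full_half_arc_split[OF half full] .
  have "p \<in> arc y (h + 1)" using p h_bounds arc_mono[of 1 "h + 1" y] by auto
  then consider "p \<in> T" | "p \<in> U" using TU by auto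
  then show thesis
  proof cases
    case 1
    then show thesis by (rule *[OF TU])
  next
    case 2
    have "arc y (h + 1) = U \<union> T" "U \<inter> T = {}" using TU(1,2) by blast+
    from this TU(4,3,6,5) 2 show thesis by (rule *)
  qed
qed

lemma dY_levels:
  assumes "p \<in> arc k 1" "q \<in> arc l 1"
  shows "dY p q = cyc_norm n (k - l)"
  unfolding dY_def
proof (rule cyc_norm_cong)
  have "n dvd Y p - k" "n dvd Y q - l"
    using arc_1[OF assms(1)] arc_1[OF assms(2)] by auto
  then have "n dvd (Y p - k) - (Y q - l)" by (rule dvd_diff)
  then show "(Y p - Y q) mod n = (k - l) mod n"
    by (simp add: mod_eq_dvd_iff algebra_simps)
qed

lemma level_in_S: "p \<in> arc k l \<Longrightarrow> p \<in> S"
  by (simp add: arc_def)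

lemma dX_pos_same_level: "p \<in> arc k 1 \<Longrightarrow> q \<in> arc k 1 \<Longrightarrow> p \<noteq> q \<Longrightarrow> dX p q > 0"
  using dY_levels[of p k q k] separated[of p q] d_nonneg[of p q] level_in_S
  by (fastforce simp: cyc_norm_def)

end

lemma sum_lessThan_10:
  "(\<Sum>i<10. f i) = f 0 + f 1 + f 2 + f 3 + f 4 + f 5 + f 6 + f 7 + f 8 + f (9::nat)"
  by (simp add: eval_nat_numeral)

section \<open>Ten points on ten levels and eleven points on eleven levels\<close>

locale gp_torus_7 = gp_torus 7 n S X Y for n :: int and S :: "'a set" and X Y
begin

text \<open>
  Every half arc has six levels, and its first triple consists of the points of the first three
  levels. By \<open>equal_turns_mod_7\<close> the first coordinate turns by the same nonzero amount at each level,
  which is impossible since neither 10 nor 11 is divisible by 7.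
\<close>
lemma not_all_levels_single:
  assumes n: "n = 10 \<or> n = 11" and one: "\<And>i::nat. lev (int i) = 1"
  shows False
proof -
  have "\<exists>p. arc (int i) 1 = {p}" for i
    using one[of i] by (simp add: lev_def card_1_singleton_iff)
  then obtain p where p: "\<And>i. arc (int i) 1 = {p i}" by metis
  have pi: "p i \<in> arc (int i) 1" for i using p by simp
  have h: "h = 5" using n by auto
  have clique: "xclique (arc (int i) 3)" for i
  proof -
    have "card (arc (int i) (int 6)) = 6" "card (arc (int i) (int 3)) = 3"
      using n card_arc_eq_sum_lev[of 6 "int i"] card_arc_eq_sum_lev[of 3 "int i"]
        one[of "i + j" for j]
      by (auto simp: one[of "i + j" for j, simplified])
    then obtain T where "T \<subseteq> arc (int i) 3" "xclique T" "card T = 3"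
      using full_half_arc_first_clique[OF _ pi, of i] h by auto
    with \<open>card (arc (int i) (int 3)) = 3\<close> show ?thesis
      by (metis card_subset_eq finite_arc of_nat_numeral)
  qed
  have mem: "p i \<in> arc (int i) 3" "p (i + 1) \<in> arc (int i) 3" "p (i + 2) \<in> arc (int i) 3" for i
    using pi[of i] pi[of "i + 1"] pi[of "i + 2"] level_in_arc[of _ "int i" 0 3]
      level_in_arc[of _ "int i" 1 3] level_in_arc[of _ "int i" 2 3] n
    by (auto simp: add.commute)
  have d: "dY (p i) (p (i + j)) = int j" if "j \<le> 2" for i j
    using dY_levels[OF pi pi, of i "i + j"] cyc_norm_small[of n "- int j"] that n by auto
  have ne: "p i \<noteq> p (i + 1)" "p i \<noteq> p (i + 2)" for i
    using d[of 1 i] d[of 2 i] dY_levels[OF pi pi, of i i] by (auto simp: cyc_norm_def)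
  define f where "f i = X (p i)" for i
  have one: "cyc_norm 7 (f (i + 1) - f i) > 1" for i
  proof -
    have "dY (p i) (p (i + 1)) < dX (p i) (p (i + 1))"
      using clique[of i] mem[of i] ne[of i] unfolding xclique_def by blast
    then show ?thesis using d[of 1 i] d_commute(1)[of "p i" "p (i + 1)"] by (simp add: f_def dX_def)
  qed
  have two: "cyc_norm 7 (f (i + 2) - f i) > 2" for i
  proof -
    have "dY (p i) (p (i + 2)) < dX (p i) (p (i + 2))"
      using clique[of i] mem[of i] ne[of i] unfolding xclique_def by blast
    then show ?thesis using d[of 2 i] d_commute(1)[of "p i" "p (i + 2)"] by (simp add: f_def dX_def)
  qed
  have "(f 1 - f 0) mod 7 = 0"
  proof (rule no_winding)
    show "(f (i + 2) - f (i + 1)) mod 7 = (f (i + 1) - f i) mod 7" for i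
      using one[of "i + 1"] one[of i] two[of i] by (intro equal_turns_mod_7) (simp_all add: add.assoc)
    have "p (nat n) = p 0" using p[of 0] p[of "nat n"] arc_add_period[of 0 1] n_pos by simp
    then show "f (nat n) mod 7 = f 0 mod 7" by (simp add: f_def)
    show "coprime 7 (int (nat n))" using n by (auto simp: coprime_iff_gcd_eq_1 gcd_non_0_int)
  qed
  then show False using one[of 0] by (simp add: cyc_norm_7)
qed

text \<open>
  A half arc starting at an occupied level has two points on its first, third and fifth level. Its
  triples consist of one point of the middle pair and one of the outer pairs each, so each point of
  the middle pair is opposite to an outer pair. The sums of the first coordinates over the five pairs
  thus form an arithmetic progression modulo 7 with nonzero difference, which does not close up.
\<close>
lemma not_alternating_pairs:
  assumes n: "n = 10" and two: "\<And>i::nat. lev (b + 2 * int i) = 2"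
    and zero: "\<And>i::nat. lev (b + 2 * int i + 1) = 0"
  shows False
proof -
  define L where "L i = arc (b + 2 * int i) 1" for i
  \<comment> \<open>Pair sums stand for the vertices opposite to the pairs, which avoids halving modulo 7.\<close>
  define s where "s i = (\<Sum>p\<in>L i. X p)" for i
  have h: "h = 5" using n by auto
  have step: "(s (i + 2) - s (i + 1)) mod 7 = (s (i + 1) - s i) mod 7 \<and> (s (i + 1) - s i) mod 7 \<noteq> 0"
    for i
  proof -
    define y where "y = b + 2 * int i"
    have lev: "lev y = 2" "lev (y + 1) = 0" "lev (y + 2) = 2" "lev (y + 3) = 0" "lev (y + 4) = 2"
      "lev (y + 5) = 0"
      using two[of i] zero[of i] two[of "i + 1"] zero[of "i + 1"] two[of "i + 2"] zero[of "i + 2"]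
      by (simp_all add: y_def algebra_simps)
    have L: "L i = arc y 1" "L (Suc i) = arc (y + 2) 1" "L (Suc (Suc i)) = arc (y + 4) 1"
      by (simp_all add: L_def y_def algebra_simps)
    have card2: "card (L i) = 2" "card (L (Suc i)) = 2" "card (L (Suc (Suc i))) = 2"
      unfolding L using lev by (simp_all add: lev_def)
    have "card (arc y (int 6)) = 6"
      using card_arc_eq_sum_lev[of 6 y] n lev by (simp add: eval_nat_numeral)
    then have full: "card (arc y (h + 1)) = 6" by (simp add: h)
    have empty: "arc (y + 1) 1 = {}" "arc (y + 3) 1 = {}" "arc (y + 5) 1 = {}"
      using lev by (simp_all add: lev_def)
    have arc3: "arc y 3 = L i \<union> L (Suc i)"
      unfolding L arc_3 empty by simp
    have "arc y (3 + 3) = arc y 3 \<union> arc (y + 3) 3" using n by (intro arc_add) auto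
    moreover have "arc (y + 3) 3 = arc (y + 3) 1 \<union> arc (y + 4) 1 \<union> arc (y + 5) 1"
      using arc_3[of "y + 3"] by (simp add: algebra_simps)
    ultimately have arc6: "arc y 6 = arc y 3 \<union> L (Suc (Suc i))" unfolding L empty by simp
    obtain a a' where a: "L i = {a, a'}" "a \<noteq> a'" using card2 by (auto simp: card_2_iff)
    obtain e u where e: "L (Suc i) = {e, u}" "e \<noteq> u" using card2 by (auto simp: card_2_iff)
    obtain c c' where c: "L (Suc (Suc i)) = {c, c'}" "c \<noteq> c'" using card2 by (auto simp: card_2_iff)
    have dY2: "dY p q = 2" if "p \<in> L i \<and> q \<in> L (Suc i) \<or> p \<in> L (Suc i) \<and> q \<in> L (Suc (Suc i))" for p q
      using that dY_levels[of p y q "y + 2"] dY_levels[of p "y + 2" q "y + 4"]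
        cyc_norm_small[of n "- 2"] n by (auto simp: L)
    have dY4: "dY p q = 4" if "p \<in> L i" "q \<in> L (Suc (Suc i))" for p q
      using that dY_levels[of p y q "y + 4"] cyc_norm_small[of n "- 4"] n by (auto simp: L)
    have far: "\<not> (p \<in> A \<and> q \<in> A)" if "xclique A" "p \<in> L i" "q \<in> L (Suc (Suc i))" for A p q
    proof
      assume "p \<in> A \<and> q \<in> A"
      moreover have "p \<noteq> q" using dY4[OF that(2,3)] by auto
      ultimately show False
        using that(1) dY4[OF that(2,3)] d_le_half(1)[of p q] by (force simp: xclique_def)
    qed
    have disj: "L i \<inter> L (Suc i) = {}" "L (Suc i) \<inter> L (Suc (Suc i)) = {}"
      using dY2 by force+
    have "a \<in> arc y 1" using a by (simp add: L[symmetric])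
    then obtain T where T: "a \<in> T" "T \<subseteq> arc y 3" "xclique T" "card T = 3"
      "xclique (arc y 6 - T)" "card (arc y 6 - T) = 3"
      using full_half_arc_first_clique[OF full] h by auto
    have cU: "c \<in> arc y 6 - T" "c' \<in> arc y 6 - T"
      using far[OF T(3), of a c] far[OF T(3), of a c'] a c T(1) arc6 by auto
    have "a' \<in> T"
      using far[OF T(5), of a' c] a c cU arc6 arc3 by auto
    then have "T = {a, a'} \<union> (T \<inter> {e, u})"
      using T(1,2) a e by (auto simp: arc3)
    moreover have "card {a, a'} = 2" using a by simp
    ultimately have "card (T \<inter> {e, u}) = 1"
      using T(4) disj a e card_Un_disjoint[of "{a, a'}" "T \<inter> {e, u}"] by auto
    then obtain e' u' where eu: "e' \<in> T" "u' \<notin> T" "{e', u'} = {e, u}" "e' \<noteq> u'"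
    proof -
      obtain x where x: "T \<inter> {e, u} = {x}" using \<open>card (T \<inter> {e, u}) = 1\<close> by (auto simp: card_1_singleton_iff)
      have "(e \<in> T \<longleftrightarrow> e = x) \<and> (u \<in> T \<longleftrightarrow> u = x) \<and> (x = e \<or> x = u)"
        using x by (auto simp: set_eq_iff)
      then consider "e \<in> T" "u \<notin> T" | "u \<in> T" "e \<notin> T" using e(2) by metis
      then show thesis using that[of e u] that[of u e] e(2) by cases auto
    qed
    have U: "u' \<in> arc y 6 - T" using eu arc6 arc3 e by auto
    have L1: "L (Suc i) = {e', u'}" using eu e by simp
    have X1: "X e' mod 7 = (4 * (X a + X a')) mod 7"
    proof (rule equidistant_pair_mod_7)
      show "cyc_norm 7 (X a - X e') > 2" "cyc_norm 7 (X a' - X e') > 2"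
        using xcliqueD[OF T(3), of a e'] xcliqueD[OF T(3), of a' e'] T(1) eu(1) \<open>a' \<in> T\<close>
          a L1 disj dY2[of a e'] dY2[of a' e'] by (auto simp: dX_def)
      show "cyc_norm 7 (X a - X a') > 0"
        using dX_pos_same_level[of a y a'] a by (simp add: L dX_def)
    qed
    have X2: "X u' mod 7 = (4 * (X c + X c')) mod 7"
    proof (rule equidistant_pair_mod_7)
      have "dY c u' = 2" "dY c' u' = 2" using dY2[of u' c] dY2[of u' c'] L1 c d_commute by auto
      moreover have "c \<noteq> u'" "c' \<noteq> u'" using disj L1 c by auto
      ultimately show "cyc_norm 7 (X c - X u') > 2" "cyc_norm 7 (X c' - X u') > 2"
        using xcliqueD[OF T(5) cU(1) U] xcliqueD[OF T(5) cU(2) U] by (auto simp: dX_def)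
      show "cyc_norm 7 (X c - X c') > 0"
        using dX_pos_same_level[of c "y + 4" c'] c by (simp add: L dX_def)
    qed
    have X3: "(X e' - X u') mod 7 \<noteq> 0"
      using dX_pos_same_level[of e' "y + 2" u'] L1 eu(4) by (auto simp: L dX_def cyc_norm_7)
    have "s i = X a + X a'" "s (Suc i) = X e' + X u'" "s (Suc (Suc i)) = X c + X c'"
      using a L1 c eu(4) by (simp_all add: s_def)
    then show ?thesis
      using second_difference_mod_7[OF X1 X2] X3 by simp
  qed
  have "(s 1 - s 0) mod 7 = 0"
  proof (rule no_winding)
    show "(s (i + 2) - s (i + 1)) mod 7 = (s (i + 1) - s i) mod 7" for i
      using step[of i] by simp
    have "L 5 = L 0" using n arc_add_period[of b 1] by (simp add: L_def)
    then show "s 5 mod 7 = s 0 mod 7" by (simp add: s_def)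
    show "coprime 7 (int 5)" by (simp add: coprime_iff_gcd_eq_1 gcd_non_0_int)
  qed
  then show False using step[of 0] by simp
qed

text \<open>
  Any two consecutive levels hold exactly two points together, so either all levels hold one point,
  or empty levels alternate with levels that hold two.
\<close>
lemma card_neq_10_if_10: assumes "n = 10" shows "card S \<noteq> 10"
proof
  assume c: "card S = 10"
  have le: "lev y + lev (y + 1) \<le> 2" for y
    using overlap_bound[of y] assms card_arc_2[of y] c by simp
  have eq: "lev y + lev (y + 1) = 2" for y
  proof -
    define f where "f i = lev (y + i)" for i
    have "f i + f (i + 1) \<le> 2" for i using le[of "y + i"] by (simp add: f_def add.assoc)
    from this[of 0] this[of 2] this[of 4] this[of 6] this[of 8]
    have "f 0 + f 1 \<le> 2" "f 2 + f 3 \<le> 2" "f 4 + f 5 \<le> 2" "f 6 + f 7 \<le> 2" "f 8 + f 9 \<le> 2"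
      by simp_all
    moreover have "f 0 + f 1 + f 2 + f 3 + f 4 + f 5 + f 6 + f 7 + f 8 + f 9 = 10"
      using card_eq_sum_lev[of y] c by (simp add: assms f_def sum_lessThan_10)
    ultimately have "f 0 + f 1 = 2" by linarith
    then show ?thesis by (simp add: f_def)
  qed
  have alt: "lev (y + 2) = lev y" for y
    using eq[of y] eq[of "y + 1"] by (simp add: add.assoc)
  have even: "lev (y + 2 * int i) = lev y" for y i
  proof (induction i)
    case (Suc i)
    then show ?case using alt[of "y + 2 * int i"] by (simp add: algebra_simps)
  qed simp
  have pairs: False if "lev b = 2" for b
  proof (rule not_alternating_pairs[OF assms])
    show "lev (b + 2 * int i) = 2" for i using even that by simp
    show "lev (b + 2 * int i + 1) = 0" for i using even[of b i] that eq[of "b + 2 * int i"] by simp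
  qed
  consider "lev 0 = 1" | "lev 0 = 2" | "lev 1 = 2" using eq[of 0] by auto linarith
  then show False
  proof cases
    case 1
    have "lev (int i) = 1" for i
    proof (induction i)
      case (Suc i)
      then show ?case using eq[of "int i"] by (simp add: add.commute)
    qed (simp add: 1)
    then show False using not_all_levels_single assms by blast
  qed (use pairs in blast)+
qed

lemma card_neq_11_if_11: assumes "n = 11" shows "card S \<noteq> 11"
proof
  assume c: "card S = 11"
  have le: "lev y \<le> 1" for y using odd_lev_bound[of y] assms c by simp
  have "lev y = 1" for y
    using card_eq_sum_lev[of y] le[of y] le[of "y + 1"] le[of "y + 2"] le[of "y + 3"] le[of "y + 4"]
      le[of "y + 5"] le[of "y + 6"] le[of "y + 7"] le[of "y + 8"] le[of "y + 9"] le[of "y + 10"]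
      assms c by (simp add: eval_nat_numeral)
  then show False using not_all_levels_single assms by blast
qed

end

section \<open>Ten points on five levels\<close>

lemma sum_lessThan_7:
  "(\<Sum>i<7. f i) = f 0 + f 1 + f 2 + f 3 + f 4 + f 5 + f (6::nat)"
  by (simp add: eval_nat_numeral)

text \<open>
  The seven sums of cyclic neighbours add up to 20, so that six of them are 3 and one is 2. The
  pattern starts behind the neighbours with sum 2.
\<close>
lemma pattern_1212121:
  fixes f :: "int \<Rightarrow> nat"
  assumes per: "\<And>k. f (k + 7) = f k" and le: "\<And>k. f k + f (k + 1) \<le> 3"
    and sum: "f 0 + f 1 + f 2 + f 3 + f 4 + f 5 + f 6 = 10"
  obtains k where "0 \<le> k" "k < 7" "f k = 1" "f (k + 1) = 2" "f (k + 2) = 1" "f (k + 3) = 2"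
    "f (k + 4) = 1" "f (k + 5) = 2" "f (k + 6) = 1"
proof -
  have forced: "a = 1 \<and> b = 2 \<and> c = 1 \<and> d = 2 \<and> e = 1 \<and> u = 2 \<and> v = 1"
    if "a + b \<le> 3" "b + c \<le> 3" "c + d \<le> 3" "d + e \<le> 3" "e + u \<le> 3" "u + v \<le> 3" "v + a = 2"
      "a + b + c + d + e + u + v = 10" for a b c d e u v :: nat
    using that by linarith
  have le': "f 0 + f 1 \<le> 3" "f 1 + f 2 \<le> 3" "f 2 + f 3 \<le> 3" "f 3 + f 4 \<le> 3" "f 4 + f 5 \<le> 3"
    "f 5 + f 6 \<le> 3" "f 6 + f 0 \<le> 3"
    using le[of 0] le[of 1] le[of 2] le[of 3] le[of 4] le[of 5] le[of 6] per[of 0] by simp_all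
  have per': "f 7 = f 0" "f 8 = f 1" "f 9 = f 2" "f 10 = f 3" "f 11 = f 4" "f 12 = f 5"
    using per[of 0] per[of 1] per[of 2] per[of 3] per[of 4] per[of 5] by simp_all
  consider "f 6 + f 0 = 2" | "f 0 + f 1 = 2" | "f 1 + f 2 = 2" | "f 2 + f 3 = 2" | "f 3 + f 4 = 2"
    | "f 4 + f 5 = 2" | "f 5 + f 6 = 2"
    using le' sum by linarith
  then show thesis
  proof cases
    case 1
    have "f 0 + f 1 + f 2 + f 3 + f 4 + f 5 + f 6 = 10" using sum by simp
    from forced[OF le'(1) le'(2) le'(3) le'(4) le'(5) le'(6) 1 this] show thesis by (intro that[of 0]) (simp_all add: per')
  next
    case 2
    have "f 1 + f 2 + f 3 + f 4 + f 5 + f 6 + f 0 = 10" using sum by simp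
    from forced[OF le'(2) le'(3) le'(4) le'(5) le'(6) le'(7) 2 this] show thesis by (intro that[of 1]) (simp_all add: per')
  next
    case 3
    have "f 2 + f 3 + f 4 + f 5 + f 6 + f 0 + f 1 = 10" using sum by simp
    from forced[OF le'(3) le'(4) le'(5) le'(6) le'(7) le'(1) 3 this] show thesis by (intro that[of 2]) (simp_all add: per')
  next
    case 4
    have "f 3 + f 4 + f 5 + f 6 + f 0 + f 1 + f 2 = 10" using sum by simp
    from forced[OF le'(4) le'(5) le'(6) le'(7) le'(1) le'(2) 4 this] show thesis by (intro that[of 3]) (simp_all add: per')
  next
    case 5
    have "f 4 + f 5 + f 6 + f 0 + f 1 + f 2 + f 3 = 10" using sum by simp
    from forced[OF le'(5) le'(6) le'(7) le'(1) le'(2) le'(3) 5 this] show thesis by (intro that[of 4]) (simp_all add: per')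
  next
    case 6
    have "f 5 + f 6 + f 0 + f 1 + f 2 + f 3 + f 4 = 10" using sum by simp
    from forced[OF le'(6) le'(7) le'(1) le'(2) le'(3) le'(4) 6 this] show thesis by (intro that[of 5]) (simp_all add: per')
  next
    case 7
    have "f 6 + f 0 + f 1 + f 2 + f 3 + f 4 + f 5 = 10" using sum by simp
    from forced[OF le'(7) le'(1) le'(2) le'(3) le'(4) le'(5) 7 this] show thesis by (intro that[of 6]) (simp_all add: per')
  qed
qed

lemma cyc_norm_5: "cyc_norm 5 z = (if z mod 5 \<le> 2 then z mod 5 else 5 - z mod 5)"
  using pos_mod_bound[of 5 z] by (auto simp: cyc_norm_def zmod_zminus1_eq_if)

text \<open>
  The counterpart of \<open>equidistant_pair_mod_7\<close>, with 3 as the inverse of 2.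
\<close>
lemma equidistant_pair_mod_5:
  assumes "cyc_norm 5 (a - e) > 1" "cyc_norm 5 (b - e) > 1" "cyc_norm 5 (a - b) > 0"
  shows "e mod 5 = (3 * (a + b)) mod 5"
proof -
  have res: "z mod 5 = 0 \<or> z mod 5 = 1 \<or> z mod 5 = 2 \<or> z mod 5 = 3 \<or> z mod 5 = 4" for z :: int
  proof -
    have "0 \<le> z mod 5" "z mod 5 < 5" by simp_all
    then show ?thesis by linarith
  qed
  define z w where "z = a - e" and "w = b - e"
  have ab: "a - b = z - w" by (simp add: z_def w_def)
  have "(3 * (z + w)) mod 5 = 0"
    using assms res[of z] res[of w] unfolding ab z_def[symmetric] w_def[symmetric]
      cyc_norm_5 mod_diff_eq[of z 5 w, symmetric] mod_add_eq[of z 5 w, symmetric]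
      mod_mult_right_eq[of 3 "z + w", symmetric]
    by (elim disjE; simp)
  then obtain k where "3 * (z + w) = 5 * k" by auto
  then have "e - 3 * (a + b) = 5 * (- k - e)" by (simp add: z_def w_def)
  then show ?thesis unfolding mod_eq_dvd_iff by (rule dvdI)
qed

context gp_torus
begin

lemma card_arc_4: "n \<ge> 4 \<Longrightarrow> card (arc y 4) = lev y + lev (y + 1) + lev (y + 2) + lev (y + 3)"
  using card_arc_eq_sum_lev[of 4 y] by (simp add: eval_nat_numeral)

lemma card_arc_3: "card (arc y 3) = lev y + lev (y + 1) + lev (y + 2)"
  using card_arc_eq_sum_lev[of 3 y] n3 by (simp add: eval_nat_numeral)

lemma dX_eq_0_iff: "dX p q = 0 \<longleftrightarrow> X p mod m = X q mod m"
  using m_pos by (simp add: dX_def cyc_norm_eq_0_iff mod_eq_dvd_iff)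

lemma lev_add_period: "lev (k + n) = lev k"
  by (rule lev_cong) simp

lemma lev_pos_obtain: assumes "lev k \<noteq> 0" obtains p where "p \<in> arc k 1"
proof -
  have "arc k 1 \<noteq> {}" using assms by (auto simp: lev_def)
  then have "\<exists>p. p \<in> arc k 1" by (simp add: ex_in_conv)
  then show thesis using that by (elim exE)
qed

end

text \<open>
  The factors are exchanged here: the levels are those of \<open>C\<^sub>7\<close>, and X-pairs live on the same or on
  adjacent levels because distances in \<open>C\<^sub>5\<close> are at most 2.
\<close>
locale gp_torus_5_7 = gp_torus 5 7 S X Y for S :: "'a set" and X Y
begin

text \<open>
  A half arc with six points starts with a triple on its first two levels. This excludes empty levels
  and adjacent levels with two points each, and leaves the pattern 1, 2, 1, 2, 1, 2, 1. A pair is at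
  distance 2 in \<open>C\<^sub>5\<close> from the single points next to it, so all single points agree in that
  coordinate. Then the first single point lies on a geodesic from the last one to the second one.
\<close>
lemma card_neq_10: "card S \<noteq> 10"
proof
  assume c: "card S = 10"
  have le2: "lev k \<le> 2" for k using odd_lev_bound[of k] c by simp
  have a4: "lev k + lev (k + 1) + lev (k + 2) + lev (k + 3) \<le> 6" for k
    using half_arc_card_le_6[of 4 k] card_arc_4[of k] by simp
  have a3: "lev k + lev (k + 1) + lev (k + 2) \<ge> 4" for k
    using short_arc_bound[of k] card_arc_3[of k] c by simp
  have first: "lev k + lev (k + 1) \<ge> 3 \<and> (lev k + lev (k + 1) = 3 \<longrightarrow> xclique (arc k 2) \<and> xclique (arc (k + 2) 2))"
    if "lev k + lev (k + 1) + lev (k + 2) + lev (k + 3) = 6" "lev k \<noteq> 0" for k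
  proof -
    have full: "card (arc k (7 div 2 + 1)) = 6" using that card_arc_4[of k] by simp
    obtain p where "p \<in> arc k 1" by (rule lev_pos_obtain[OF \<open>lev k \<noteq> 0\<close>])
    from full_half_arc_first_clique[OF full this] obtain T where
      "T \<subseteq> arc k (5 div 2)" "xclique T" "card T = 3" "xclique (arc k (7 div 2 + 1) - T)" .
    then have T: "T \<subseteq> arc k 2" "xclique T" "card T = 3" "xclique (arc k 4 - T)" by simp_all
    have c2: "card (arc k 2) = lev k + lev (k + 1)" by (rule card_arc_2) simp
    have "3 \<le> card (arc k 2)" using T card_mono[of "arc k 2" T] by simp
    moreover have "xclique (arc k 2) \<and> xclique (arc (k + 2) 2)" if "card (arc k 2) = 3"
    proof -
      have "T = arc k 2" using T that by (intro card_subset_eq) auto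
      moreover from this have "arc k 4 - T = arc (k + 2) 2"
        using arc_add[of 2 2 k] by auto
      ultimately show ?thesis using T by simp
    qed
    ultimately show ?thesis using c2 by simp
  qed
  have shift: "k - 2 + 1 = k - 1" "k - 2 + 2 = k" "k - 2 + 3 = k + 1" "k - 1 + 1 = k"
    "k - 1 + 2 = k + 1" "k - 1 + 3 = k + 2" for k :: int by simp_all
  have nz: "lev k \<noteq> 0" for k
  proof
    assume z: "lev k = 0"
    have "lev (k + 1) = 2" "lev (k + 2) = 2" "lev (k - 1) = 2"
      using a3[of k] a3[of "k - 2"] le2[of "k + 1"] le2[of "k + 2"] le2[of "k - 1"] le2[of "k - 2"] z
      unfolding shift by linarith+
    then show False using first[of "k - 1"] z unfolding shift by simp
  qed
  have le3: "lev k + lev (k + 1) \<le> 3" for k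
  proof (rule ccontr)
    assume "\<not> lev k + lev (k + 1) \<le> 3"
    then have "lev k = 2" "lev (k + 1) = 2" using le2[of k] le2[of "k + 1"] by linarith+
    then show False
      using a4[of "k - 2"] first[of "k - 2"] nz[of "k - 2"] nz[of "k - 1"] unfolding shift by linarith
  qed
  obtain k where k: "lev k = 1" "lev (k + 1) = 2" "lev (k + 2) = 1" "lev (k + 3) = 2"
    "lev (k + 4) = 1" "lev (k + 5) = 2" "lev (k + 6) = 1"
  proof (rule pattern_1212121[of lev])
    show "lev 0 + lev 1 + lev 2 + lev 3 + lev 4 + lev 5 + lev 6 = 10"
      using card_eq_sum_lev[of 0] c by (simp add: sum_lessThan_7)
  qed (use lev_add_period le3 that in auto)
  have cliques: "xclique (arc k 2)" "xclique (arc (k + 1) 2)" "xclique (arc (k + 2) 2)"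
    "xclique (arc (k + 3) 2)" "xclique (arc (k + 4) 2)" "xclique (arc (k + 5) 2)"
    using first[of k] first[of "k + 1"] first[of "k + 2"] first[of "k + 3"] k
    by (simp_all add: add.assoc)
  have pass: "X a mod 5 = X b mod 5"
    if prem: "lev (y + 1) = 2" "xclique (arc y 2)" "xclique (arc (y + 1) 2)" "a \<in> arc y 1" "b \<in> arc (y + 2) 1"
    for a b y
  proof -
    obtain q q' where q: "arc (y + 1) 1 = {q, q'}" "q \<noteq> q'"
      using prem(1) by (auto simp: lev_def card_2_iff)
    have mem: "a \<in> arc y 2" "q \<in> arc y 2" "q' \<in> arc y 2"
      "b \<in> arc (y + 1) 2" "q \<in> arc (y + 1) 2" "q' \<in> arc (y + 1) 2"
      using prem q arc_2[of y] arc_2[of "y + 1"] by (auto simp: add.assoc)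
    have d1: "dY r a = 1" "dY r b = 1" if "r \<in> {q, q'}" for r
      using dY_levels[of r "y + 1" a y] dY_levels[of r "y + 1" b "y + 2"] that q
        \<open>a \<in> arc y 1\<close> \<open>b \<in> arc (y + 2) 1\<close> cyc_norm_small[of 7 1] cyc_norm_small[of 7 "-1"] by auto
    then have ne: "r \<noteq> a" "r \<noteq> b" if "r \<in> {q, q'}" for r
      using that by fastforce+
    have far: "dX r a > 1" "dX r b > 1" if "r \<in> {q, q'}" for r
    proof -
      have "r \<in> arc y 2" "r \<in> arc (y + 1) 2" using that mem by auto
      then have "dY r a < dX r a" "dY r b < dX r b"
        using xcliqueD[OF prem(2), of r a] xcliqueD[OF prem(3), of r b] mem ne[OF that] by simp_all
      then show "dX r a > 1" "dX r b > 1" using d1[OF that] by simp_all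
    qed
    have "dX q q' > 0" using dX_pos_same_level[of q "y + 1" q'] q by simp
    then show ?thesis
      using far[of q] far[of q'] equidistant_pair_mod_5[of "X q" "X a" "X q'"]
        equidistant_pair_mod_5[of "X q" "X b" "X q'"] by (simp add: dX_def)
  qed
  obtain a where a: "a \<in> arc k 1" by (rule lev_pos_obtain[OF nz])
  obtain b where b: "b \<in> arc (k + 2) 1" by (rule lev_pos_obtain[OF nz])
  obtain c where c: "c \<in> arc (k + 4) 1" by (rule lev_pos_obtain[OF nz])
  obtain d where d: "d \<in> arc (k + 6) 1" by (rule lev_pos_obtain[OF nz])
  have "X a mod 5 = X b mod 5" by (rule pass[OF k(2) cliques(1,2) a b])
  moreover have "X b mod 5 = X c mod 5" "X c mod 5 = X d mod 5"
    using pass[of "k + 2" b c] pass[of "k + 4" c d] k(4,6) cliques(3-6) b c d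
    by (simp_all add: add.assoc)
  ultimately have X: "dX d b = 0" "dX d a = 0" "dX a b = 0"
    by (simp_all add: dX_eq_0_iff)
  have Y: "dY d b = 3" "dY d a = 1" "dY a b = 2"
    using dY_levels[OF d b] dY_levels[OF d a] dY_levels[OF a b] by (simp_all add: cyc_norm_def)
  then have "d \<noteq> b" "a \<noteq> d" "a \<noteq> b" by auto
  then show False
    using no_between[of d b a] X Y a b d level_in_S by auto
qed

end

section \<open>Profiles of ten points on at least twelve levels\<close>


text \<open>
  What is needed about the numbers \<open>f k\<close> of points on the levels in order to exclude ten points on 12
  to 15 levels, where \<open>h\<close> is half the number of levels, rounded down. Three consecutive levels carry
  an X-clique (\<open>window\<close>); points whose levels are at least 3 apart form Y-pairs, which do not form
  chains (\<open>chain\<close>), are not short (\<open>near\<close>), and have a neighbourhood with at least seven points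
  (\<open>spread\<close>, \<open>middle\<close>). If three windows cover all occupied levels, the total of 10 is
  contradicted.
\<close>
locale level_profile =
  fixes n h :: int and f :: "int \<Rightarrow> nat"
  assumes per: "f (k + n) = f k"
    and window: "f k + f (k + 1) + f (k + 2) \<le> 3"
    and chain: "3 \<le> i \<Longrightarrow> 3 \<le> j \<Longrightarrow> i + j \<le> h \<Longrightarrow> f k = 0 \<or> f (k + i) = 0 \<or> f (k + i + j) = 0"
    and near: "3 \<le> s \<Longrightarrow> s \<le> h - 4 \<Longrightarrow> f k = 0 \<or> f (k + s) = 0"
    and spread: "f k \<noteq> 0 \<Longrightarrow> f (k + (h - 3)) \<noteq> 0 \<Longrightarrow> f (k - 2) \<noteq> 0 \<and> f (k + (h - 1)) \<noteq> 0"
    and middle: "h = 6 \<Longrightarrow> f k \<noteq> 0 \<Longrightarrow> f (k + 3) \<noteq> 0 \<Longrightarrow> f (k + 1) \<noteq> 0 \<or> f (k + 2) \<noteq> 0"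
    and total: "(\<Sum>i<nat n. f (int i)) = 10"
begin

lemma no_gap_3_if_12:
  assumes n: "n = 12" and h: "h = 6" and occ: "f 0 \<noteq> 0" "f 3 \<noteq> 0"
  shows False
proof -
  have p: "f 12 = f 0" "f 13 = f 1" "f 14 = f 2" "f 15 = f 3" "f 16 = f 4" "f 17 = f 5"
    "f (-2) = f 10" "f (-4) = f 8"
    using per[of 0] per[of 1] per[of 2] per[of 3] per[of 4] per[of 5] per[of "- 2"] per[of "- 4"] n
    by simp_all
  have sum: "f 0 + f 1 + f 2 + f 3 + f 4 + f 5 + f 6 + f 7 + f 8 + f 9 + f 10 + f 11 = 10"
    using total n by (simp add: eval_nat_numeral)
  have ends: "f 10 \<noteq> 0" "f 5 \<noteq> 0" using spread[of 0] occ p h by simp_all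
  have z: "f 6 = 0" "f 9 = 0" using chain[of 3 3 0] chain[of 3 3 9] occ p h by simp_all
  consider "f 1 \<noteq> 0" | "f 2 \<noteq> 0" using middle[of 0] occ h by auto
  then show False
  proof cases
    case 1
    have "f 8 \<noteq> 0" using spread[of "- 2"] 1 ends p h by simp
    then have "f 11 = 0" "f 2 = 0" "f 4 = 0" "f 7 = 0"
      using chain[of 3 3 5] chain[of 3 3 2] chain[of 3 3 "- 2"] chain[of 3 3 7] 1 ends p h by simp_all
    then show False using sum z window[of 8] window[of 0] window[of 3] by simp
  next
    case 2
    have "f 7 \<noteq> 0" using spread[of 2] 2 ends p h by simp
    then have "f 1 = 0" "f 4 = 0" "f 11 = 0" "f 8 = 0"
      using chain[of 3 3 7] chain[of 3 3 4] chain[of 3 3 11] chain[of 3 3 2] 2 ends p h by simp_all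
    then show False using sum z window[of 5] window[of 2] window[of 10] p by simp
  qed
qed

text \<open>
  Each odd level is 3 apart from one of the levels 0, 2 and 4.
\<close>
lemma no_even_run_if_12:
  assumes n: "n = 12" and h: "h = 6" and occ: "f 0 \<noteq> 0" "f 2 \<noteq> 0" "f 4 \<noteq> 0"
    and gap: "\<And>k. f k = 0 \<or> f (k + 3) = 0"
  shows False
proof -
  have p: "f 12 = f 0" "f 14 = f 2" using per[of 0] per[of 2] n by simp_all
  have sum: "f 0 + f 1 + f 2 + f 3 + f 4 + f 5 + f 6 + f 7 + f 8 + f 9 + f 10 + f 11 = 10"
    using total n by (simp add: eval_nat_numeral)
  have "f 1 = 0" "f 3 = 0" "f 5 = 0" "f 7 = 0" "f 9 = 0" "f 11 = 0"
    using gap[of 1] gap[of 0] gap[of 2] gap[of 4] gap[of 9] gap[of 11] occ p by simp_all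
  then show False using sum window[of 0] window[of 4] window[of 8] by simp
qed

text \<open>
  In contrast to 12 levels two kinds of profiles survive. In the first one the occupied levels form a
  cycle of length seven with steps of two levels and one step of one level; in the second one four
  consecutive levels are occupied and the other steps have two levels.
\<close>
lemma gap_3_if_13:
  assumes n: "n = 13" and h: "h = 6" and occ: "f 0 \<noteq> 0" "f 3 \<noteq> 0"
  shows "\<exists>k. f k + f (k + 2) + f (k + 4) + f (k + 6) + f (k + 8) + f (k + 10) + f (k + 12) = 10 \<or>
    f k = 1 \<and> f (k + 1) = 1 \<and> f (k + 2) = 1 \<and> f (k + 3) = 1 \<and>
    f (k + 5) + f (k + 7) + f (k + 9) + f (k + 11) = 6"
proof -
  have p: "f 13 = f 0" "f 14 = f 1" "f 15 = f 2" "f 16 = f 3" "f 17 = f 4" "f 18 = f 5" "f 19 = f 6"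
    "f 20 = f 7" "f 21 = f 8" "f 22 = f 9" "f (-2) = f 11" "f (-4) = f 9"
    using per[of 0] per[of 1] per[of 2] per[of 3] per[of 4] per[of 5] per[of 6] per[of 7] per[of 8]
      per[of 9] per[of "- 2"] per[of "- 4"] n
    by simp_all
  have sum: "f 0 + f 1 + f 2 + f 3 + f 4 + f 5 + f 6 + f 7 + f 8 + f 9 + f 10 + f 11 + f 12 = 10"
    using total n by (simp add: eval_nat_numeral)
  have ends: "f 11 \<noteq> 0" "f 5 \<noteq> 0" using spread[of 0] occ p h by simp_all
  have z: "f 6 = 0" "f 10 = 0" using chain[of 3 3 0] chain[of 3 3 10] occ p h by simp_all
  show ?thesis
  proof (cases "f 1 = 0")
    case False
    have f9: "f 9 \<noteq> 0" using spread[of "- 2"] False ends p h by simp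
    have z': "f 4 = 0" "f 8 = 0"
      using chain[of 3 3 11] chain[of 3 3 8] False ends p h by simp_all
    consider "f 2 = 0" "f 12 = 0" | "f 2 \<noteq> 0" "f 12 = 0" | "f 2 = 0" "f 12 \<noteq> 0"
      using chain[of 3 3 9] f9 p h by auto
    then show ?thesis
    proof cases
      case 1
      then show ?thesis using sum z z' p by (intro exI[of _ 1]) simp
    next
      case 2
      then have "f 0 = 1" "f 1 = 1" "f 2 = 1" "f 3 = 1"
        using window[of 0] window[of 1] occ False by simp_all
      then show ?thesis using 2 sum z z' p by (intro exI[of _ 0]) simp
    next
      case 3
      then have "f 11 = 1" "f 12 = 1" "f 0 = 1" "f 1 = 1"
        using window[of 11] window[of 12] occ ends False p by simp_all
      then show ?thesis using 3 sum z z' p by (intro exI[of _ 11]) simp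
    qed
  next
    case True
    have f2: "f 2 \<noteq> 0" using middle[of 0] True occ h by simp
    have "f 7 \<noteq> 0" using spread[of 2] f2 ends p h by simp
    have z': "f 12 = 0" "f 8 = 0"
      using chain[of 3 3 12] chain[of 3 3 5] f2 ends p h by simp_all
    show ?thesis
    proof (cases "f 4 = 0")
      case f4: True
      then show ?thesis using sum True z z' p by (intro exI[of _ 3]) simp
    next
      case False
      then have "f 2 = 1" "f 3 = 1" "f 4 = 1" "f 5 = 1"
        using window[of 2] window[of 3] f2 occ ends by simp_all
      then show ?thesis using sum True z z' p by (intro exI[of _ 2]) simp
    qed
  qed
qed

lemma no_even_run_if_13:
  assumes n: "n = 13" and h: "h = 6" and occ: "f 0 \<noteq> 0" "f 2 \<noteq> 0" "f 4 \<noteq> 0"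
    and gap: "\<And>k. f k = 0 \<or> f (k + 3) = 0"
  shows False
proof -
  have p: "f 13 = f 0" "f 14 = f 1" "f 15 = f 2" using per[of 0] per[of 1] per[of 2] n by simp_all
  have sum: "f 0 + f 1 + f 2 + f 3 + f 4 + f 5 + f 6 + f 7 + f 8 + f 9 + f 10 + f 11 + f 12 = 10"
    using total n by (simp add: eval_nat_numeral)
  have z: "f 1 = 0" "f 3 = 0" "f 5 = 0" "f 7 = 0" "f 10 = 0" "f 12 = 0"
    using gap[of 1] gap[of 0] gap[of 2] gap[of 4] gap[of 10] gap[of 12] occ p by simp_all
  consider "f 9 = 0" "f 11 = 0" | "f 9 = 0" "f 8 = 0" | "f 6 = 0" "f 11 = 0" | "f 6 = 0" "f 8 = 0"
    using gap[of 6] gap[of 8] by auto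
  then show False
  proof cases
    case 1 then show False using sum z window[of 0] window[of 4] window[of 6] window[of 8] by simp
  next
    case 2 then show False using sum z window[of 11] window[of 2] window[of 6] p by simp
  next
    case 3 then show False using sum z window[of 0] window[of 4] window[of 8] by simp
  next
    case 4 then show False using sum z window[of 9] window[of 0] window[of 4] by simp
  qed
qed

text \<open>
  Levels 3 apart are not both occupied, so that level 9 is the only odd level that may be occupied. In
  this case three windows cover all occupied levels.
\<close>
lemma even_run_if_14:
  assumes n: "n = 14" and h: "h = 7" and occ: "f 0 \<noteq> 0" "f 2 \<noteq> 0" "f 4 \<noteq> 0"
  shows "f 0 + f 2 + f 4 + f 6 + f 8 + f 10 + f 12 = 10"
proof -
  have gap: "f k = 0 \<or> f (k + 3) = 0" for k using near[of 3 k] h by simp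
  have p: "f 14 = f 0" "f 16 = f 2" using per[of 0] per[of 2] n by simp_all
  have sum: "f 0 + f 1 + f 2 + f 3 + f 4 + f 5 + f 6 + f 7 + f 8 + f 9 + f 10 + f 11 + f 12 + f 13 = 10"
    using total n by (simp add: eval_nat_numeral)
  have z: "f 1 = 0" "f 3 = 0" "f 5 = 0" "f 7 = 0" "f 11 = 0" "f 13 = 0"
    using gap[of 1] gap[of 0] gap[of 2] gap[of 4] gap[of 11] gap[of 13] occ p by simp_all
  have "f 9 = 0"
  proof (rule ccontr)
    assume "f 9 \<noteq> 0"
    then have "f 6 = 0" "f 12 = 0" using gap[of 6] gap[of 9] by simp_all
    then show False using sum z window[of 8] window[of 0] window[of 4] by simp
  qed
  then show ?thesis using sum z by simp
qed

lemma no_even_run_if_15: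
  assumes n: "n = 15" and h: "h = 7" and occ: "f 0 \<noteq> 0" "f 2 \<noteq> 0" "f 4 \<noteq> 0"
  shows False
proof -
  have gap: "f k = 0 \<or> f (k + 3) = 0" for k using near[of 3 k] h by simp
  have p: "f 15 = f 0" "f 17 = f 2" "f (-2) = f 13" using per[of 0] per[of 2] per[of "- 2"] n by simp_all
  have sum: "f 0 + f 1 + f 2 + f 3 + f 4 + f 5 + f 6 + f 7 + f 8 + f 9 + f 10 + f 11 + f 12 + f 13 + f 14 = 10"
    using total n by (simp add: eval_nat_numeral)
  have z: "f 1 = 0" "f 3 = 0" "f 5 = 0" "f 7 = 0" "f 12 = 0" "f 14 = 0"
    using gap[of 1] gap[of 0] gap[of 2] gap[of 4] gap[of 12] gap[of 14] occ p by simp_all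
  have ends: "f 13 \<noteq> 0" "f 6 \<noteq> 0" using spread[of 0] occ p h by simp_all
  have z': "f 9 = 0" "f 10 = 0" using gap[of 6] gap[of 10] ends by simp_all
  consider "f 8 = 0" | "f 11 = 0" using gap[of 8] by auto
  then show False
  proof cases
    case 1 then show False using sum z z' window[of 11] window[of 0] window[of 4] by simp
  next
    case 2 then show False using sum z z' window[of 13] window[of 2] window[of 6] p by simp
  qed
qed

end

section \<open>At least twelve levels\<close>


text \<open>
  Two vertices on both sides of a pair \<open>q\<close>, \<open>q'\<close>: the vertex \<open>a\<close> is opposite to the edge \<open>q\<close>\<open>q'\<close>, and the
  only vertices at distance at least 2 from \<open>q\<close> and \<open>q'\<close> are \<open>a\<close> and its neighbours.
\<close>
lemma pass_mod_7:
  assumes "cyc_norm 7 (a - q) > 2" "cyc_norm 7 (a - q') > 2" "cyc_norm 7 (b - q) > 1"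
    "cyc_norm 7 (b - q') > 1" "cyc_norm 7 (q - q') > 0"
  shows "cyc_norm 7 (a - b) \<le> 1"
proof -
  define x y z where "x = (a - q) mod 7" and "y = (a - q') mod 7" and "z = (b - q) mod 7"
  have far: "v mod 7 \<in> {3, 4}" if "cyc_norm 7 v > 2" for v
    using that unfolding cyc_norm_7 by (cases v rule: residue_7_cases) simp_all
  have away: "v mod 7 \<in> {2, 3, 4, 5}" if "cyc_norm 7 v > 1" for v
    using that unfolding cyc_norm_7 by (cases v rule: residue_7_cases) simp_all
  have "(b - q') mod 7 = ((b - q) + ((a - q') - (a - q))) mod 7" by simp
  also have "\<dots> = (z + (y - x)) mod 7"
    unfolding x_def y_def z_def by (intro mod_add_cong) (simp_all add: mod_diff_eq)
  finally have w: "(z + (y - x)) mod 7 \<in> {2, 3, 4, 5}" using away[OF assms(4)] by simp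
  have "x \<noteq> y"
  proof
    assume "x = y"
    then have "7 dvd (a - q) - (a - q')" by (simp only: x_def y_def mod_eq_dvd_iff)
    moreover have "(a - q) - (a - q') = - (q - q')" by simp
    ultimately have "7 dvd q - q'" by (simp only: dvd_minus_iff)
    then show False using assms(5) cyc_norm_eq_0_iff[of 7 "q - q'"] by simp
  qed
  moreover have "x \<in> {3, 4}" "y \<in> {3, 4}" "z \<in> {2, 3, 4, 5}"
    using far[OF assms(1)] far[OF assms(2)] away[OF assms(3)] by (simp_all only: x_def y_def z_def)
  ultimately have "(x - z) mod 7 \<in> {0, 1, 6}" using w by auto
  moreover have "(a - b) mod 7 = (x - z) mod 7"
    using mod_diff_eq[of "a - q" 7 "b - q"] by (simp add: x_def z_def)
  ultimately show ?thesis unfolding cyc_norm_7 by auto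
qed

context gp_torus
begin

text \<open>
  Otherwise being equal or an X-pair is an equivalence relation. Its classes are X-cliques and its
  representatives form a Y-clique, so there are at most nine points.
\<close>
lemma xpairs_not_transitive:
  assumes "card S \<ge> 10"
  shows "\<exists>u\<in>S. \<exists>w\<in>S. \<exists>v\<in>S. u \<noteq> v \<and> dY u w < dX u w \<and> dY w v < dX w v \<and> dX u v \<le> dY u v"
proof (rule ccontr)
  assume no: "\<not> ?thesis"
  have tr: "dY u v < dX u v"
    if "u \<in> S" "w \<in> S" "v \<in> S" "u \<noteq> v" "dY u w < dX u w" "dY w v < dX w v" for u w v
  proof (rule ccontr)
    assume "\<not> dY u v < dX u v"
    then have "dX u v \<le> dY u v" by simp
    with no that show False by blast
  qed
  define R where "R = {(p, q). p \<in> S \<and> q \<in> S \<and> (p = q \<or> dY p q < dX p q)}"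
  have R: "equiv S R"
  proof (rule equivI)
    show "R \<subseteq> S \<times> S" "refl_on S R" by (auto simp: R_def refl_on_def)
    show "sym R" by (rule symI) (auto simp: R_def d_commute)
    show "trans R" by (rule transI) (use tr in \<open>auto simp: R_def\<close>)
  qed
  have clique: "xclique C" if C: "C \<in> S // R" for C
    unfolding xclique_def
  proof (intro conjI ballI impI)
    show "C \<subseteq> S" using R C by (rule in_quotient_imp_subset)
    fix p q assume "p \<in> C" "q \<in> C" "p \<noteq> q"
    then show "dY p q < dX p q" using in_quotient_imp_in_rel[OF R C, of p q] by (auto simp: R_def)
  qed
  define r where "r C = (SOME p. p \<in> C)" for C :: "'a set"
  have r: "r C \<in> C" if "C \<in> S // R" for C
    using in_quotient_imp_non_empty[OF R that] by (auto simp: r_def some_in_eq)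
  have fq: "finite (S // R)" using fin R by (auto intro: finite_quotient simp: equiv_def)
  have distinct: "(r C, r D) \<notin> R" if "C \<in> S // R" "D \<in> S // R" "C \<noteq> D" for C D
    using quotient_eq_iff[OF R that(1,2) r r] that by auto
  have "card (r ` (S // R)) \<le> 3"
  proof (rule yclique_card_le_3)
    show "r ` (S // R) \<subseteq> S" using r in_quotient_imp_subset[OF R] by blast
    fix p q assume "p \<in> r ` (S // R)" "q \<in> r ` (S // R)" "p \<noteq> q"
    then obtain C D where "p = r C" "q = r D" "C \<in> S // R" "D \<in> S // R" "C \<noteq> D" by auto
    then show "dX p q \<le> dY p q"
      using distinct[of C D] r in_quotient_imp_subset[OF R] by (fastforce simp: R_def not_less)
  qed
  moreover have "inj_on r (S // R)"
  proof (rule inj_onI, rule ccontr)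
    fix C D assume *: "C \<in> S // R" "D \<in> S // R" "r C = r D" "C \<noteq> D"
    then have "r C \<in> S" using r in_quotient_imp_subset[OF R] by blast
    then show False using distinct[of C D] * by (simp add: R_def)
  qed
  ultimately have 3: "card (S // R) \<le> 3" by (simp add: card_image)
  have "card S = card (\<Union> (S // R))" by (simp add: Union_quotient[OF R])
  also have "\<dots> \<le> (\<Sum>C\<in>S // R. card C)" using card_Union_le_sum_card .
  also have "\<dots> \<le> (\<Sum>C\<in>S // R. 3)"
    using clique by (intro sum_mono xclique_card_le_3) auto
  also have "\<dots> \<le> 9" using 3 by simp
  finally show False using assms by simp
qed

lemma dY_oriented:
  "(Y q - Y p) mod n = dY p q mod n \<or> (Y p - Y q) mod n = dY p q mod n"
  unfolding dY_def cyc_norm_def by (auto simp: min_def)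

end

text \<open>
  The assumptions are contradictory, which is the aim of this context.
\<close>
locale ten_points = gp_torus_7 +
  assumes n12: "n \<ge> 12" and card10: "card S = 10"
begin

lemma dX_le_3: "dX p q \<le> 3"
  using d_le_half(1)[of p q] by simp

lemma h6: "h \<ge> 6" and h_cases: "n = 2 * h \<or> n = 2 * h + 1"
  using n12 by auto

text \<open>
  By \<open>no_chain\<close>, a point outside the \<open>s + 5\<close> levels around \<open>u\<close> and \<open>v\<close> can neither continue the Y-pair
  upwards within half of the cycle nor downwards; so it lies on one of the at most \<open>s\<close> levels that are
  more than \<open>h\<close> above \<open>u\<close> and more than \<open>h\<close> below \<open>v\<close>. Two such points cannot form a Y-pair, as \<open>v\<close> would
  extend it to a chain. So these points form an X-clique and at most three points are outside.
\<close>
lemma ypair_neighbourhood: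
  assumes uv: "u \<in> S" "v \<in> S" and s: "(Y v - Y u) mod n = s mod n" "1 \<le> s" "s \<le> h - 2" "dX u v \<le> s"
  shows "7 \<le> card (arc (Y u - 2) (s + 5))"
proof -
  define A where "A = arc (Y u - 2) (s + 5)"
  \<comment> \<open>The height of \<open>z\<close> above \<open>u\<close>, normalised to the range from \<open>- 2\<close> to \<open>n - 3\<close>.\<close>
  define i where "i z = (Y z - (Y u - 2)) mod n - 2" for z
  have i: "(Y z - Y u) mod n = i z mod n" for z
    by (simp add: i_def mod_diff_left_eq)
  have vz: "(Y z - Y v) mod n = (i z - s) mod n" for z
    using mod_diff_cong[OF i[of z] s(1)] by simp
  have zu: "(Y u - Y z) mod n = (n - i z) mod n" for z
  proof -
    have "(Y u - Y z) mod n = (- i z) mod n" using mod_minus_cong[OF i[of z]] by simp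
    also have "\<dots> = (- i z + n) mod n" by (rule mod_add_self2[symmetric])
    also have "- i z + n = n - i z" by simp
    finally show ?thesis .
  qed
  have diff: "(Y z' - Y z) mod n = (i z' - i z) mod n" for z z'
    using mod_diff_cong[OF i[of z'] i[of z]] by simp
  have B: "s + 3 \<le> i z" "i z \<le> n - 3" if "z \<in> S - A" for z
  proof -
    have "(Y z - (Y u - 2)) mod n < n" using n_pos by simp
    then show "i z \<le> n - 3" by (simp add: i_def)
    show "s + 3 \<le> i z" using that by (auto simp: A_def arc_def i_def)
  qed
  have B': "h < i z" "i z < n - h + s" if z: "z \<in> S - A" for z
  proof -
    have zS: "z \<in> S" using z by simp
    show "h < i z"
    proof (rule ccontr)
      assume "\<not> h < i z"
      then have "2 * (s + (i z - s)) \<le> n" using h_bounds by simp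
      moreover have "0 < i z - s" "dX v z \<le> i z - s" using B[OF z] dX_le_3[of v z] by simp_all
      ultimately show False
        using no_chain[OF uv(1,2) zS s(1) _ s(4) vz] s(2) by simp
    qed
    show "i z < n - h + s"
    proof (rule ccontr)
      assume "\<not> i z < n - h + s"
      then have "2 * ((n - i z) + s) \<le> n" using h_bounds by simp
      moreover have "0 < n - i z" "dX z u \<le> n - i z" using B[OF z] dX_le_3[of z u] by simp_all
      ultimately show False
        using no_chain[OF zS uv zu _ _ s(1) _ s(4)] s(2) by simp
    qed
  qed
  have order: "dY p q < dX p q" if pq: "p \<in> S - A" "q \<in> S - A" "p \<noteq> q" "i p \<le> i q" for p q
  proof (rule ccontr)
    assume "\<not> dY p q < dX p q"
    then have le: "dX p q \<le> dY p q" by simp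
    have pS: "p \<in> S" and qS: "q \<in> S" using pq by auto
    have "2 * (b - a) \<le> n" if "H < a" "b < n - H + s" "s \<le> H - 2" "n \<le> 2 * H + 1" for a b H
      using that by (simp add: algebra_simps)
    from this[OF B'(1)[OF pq(1)] B'(2)[OF pq(2)] s(3) h_bounds(2)]
    have small: "2 * (i q - i p) \<le> n" .
    have dY: "dY p q = i q - i p"
      using cyc_norm_cong[OF diff[of q p]] cyc_norm_small[OF n_pos, of "i q - i p"] small pq(4)
        d_commute(2)[of p q] by (simp add: dY_def)
    then have "i p \<noteq> i q" using le separated[of p q] d_nonneg[of p q] pq by auto
    then have "0 < i q - i p" using pq(4) by simp
    moreover have "0 < i p - s" "dX v p \<le> i p - s"
      using B[OF pq(1)] dX_le_3[of v p] by simp_all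
    moreover have "2 * ((a - s) + (b - a)) \<le> n" if "b < n - H + s" "n \<le> 2 * H + 1" for a b H
      using that by (simp add: algebra_simps)
    note this[OF B'(2)[OF pq(2)] h_bounds(2), of "i p"]
    ultimately show False
      using no_chain[OF uv(2) pS qS vz _ _ diff] le dY by simp
  qed
  have "xclique (S - A)"
    unfolding xclique_def
  proof (intro conjI ballI impI)
    fix p q assume "p \<in> S - A" "q \<in> S - A" "p \<noteq> q"
    then show "dY p q < dX p q"
      using order[of p q] order[of q p] d_commute[of p q] by (cases "i p \<le> i q") auto
  qed auto
  then have "card (S - A) \<le> 3" by (rule xclique_card_le_3)
  moreover have "card (S - A) = card S - card A"
    using arc_subset by (intro card_Diff_subset) (auto simp: A_def)
  ultimately show ?thesis using card10 by (simp add: A_def)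
qed

text \<open>
  For \<open>s \<le> h - 4\<close> the neighbourhood of the Y-pair fits into a half arc, which cannot hold seven points.
\<close>
lemma short_ypair_free:
  assumes "u \<in> S" "v \<in> S" "(Y v - Y u) mod n = s mod n" "1 \<le> s" "s \<le> h - 4" "dX u v \<le> s"
  shows False
proof -
  have "7 \<le> card (arc (Y u - 2) (s + 5))" using assms by (intro ypair_neighbourhood) auto
  moreover have "card (arc (Y u - 2) (s + 5)) \<le> 6"
    using assms h_bounds by (intro half_arc_card_le_6) simp
  ultimately show False by simp
qed

lemma short_xpair:
  assumes "p \<in> S" "q \<in> S" "p \<noteq> q" "dY p q \<le> h - 4"
  shows "dY p q < dX p q"
proof (rule ccontr)
  assume "\<not> dY p q < dX p q"
  then have le: "dX p q \<le> dY p q" by simp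
  then have "1 \<le> dY p q" using separated[OF assms(1-3)] d_nonneg[of p q] by auto
  then show False
    using dY_oriented[of q p] short_ypair_free[of p q "dY p q"] short_ypair_free[of q p "dY p q"]
      assms le d_commute[of p q] by auto
qed

lemma close_xpair: "p \<in> S \<Longrightarrow> q \<in> S \<Longrightarrow> p \<noteq> q \<Longrightarrow> dY p q \<le> 2 \<Longrightarrow> dY p q < dX p q"
  using short_xpair[of p q] h6 by simp

lemma oriented_mod:
  assumes "p \<in> S" "q \<in> S" "dY p q \<le> 2"
  obtains a where "(Y q - Y p) mod n = a mod n" "\<bar>a\<bar> \<le> 2"
proof -
  consider "(Y q - Y p) mod n = dY p q mod n" | "(Y p - Y q) mod n = dY p q mod n"
    using dY_oriented by blast
  then show thesis
  proof cases
    case 1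
    then show thesis using assms d_nonneg by (intro that[of "dY p q"]) auto
  next
    case 2
    then have "(Y q - Y p) mod n = (- dY p q) mod n" using mod_minus_cong[OF 2] by simp
    then show thesis using assms d_nonneg by (intro that[of "- dY p q"]) auto
  qed
qed

lemma lev_nonzero:
  assumes "q \<in> S" "(Y q - Y p) mod n = c mod n"
  shows "lev (Y p + c) \<noteq> 0"
proof -
  have "n dvd (Y q - Y p) - c" using assms(2) by (simp only: mod_eq_dvd_iff)
  then have "(Y q - (Y p + c)) mod n = 0" by (simp add: algebra_simps)
  then have "q \<in> arc (Y p + c) 1" using assms(1) by (simp add: arc_def)
  then show ?thesis by (auto simp: lev_def)
qed

text \<open>
  Two X-pairs \<open>u\<close>, \<open>w\<close> and \<open>w\<close>, \<open>v\<close> with a Y-pair \<open>u\<close>, \<open>v\<close> are provided by \<open>xpairs_not_transitive\<close>. The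
  levels of X-pairs are at most 2 apart, those of the Y-pair more than \<open>h - 4\<close>.
\<close>
lemma obtain_close_levels:
  obtains (three) k where "lev k \<noteq> 0" "lev (k + 3) \<noteq> 0" "h \<le> 7"
  | (two_two) k where "lev k \<noteq> 0" "lev (k + 2) \<noteq> 0" "lev (k + 4) \<noteq> 0" "h \<le> 7"
proof -
  obtain u w v where uwv: "u \<in> S" "w \<in> S" "v \<in> S" "u \<noteq> v" "dY u w < dX u w" "dY w v < dX w v"
    "dX u v \<le> dY u v"
    using xpairs_not_transitive card10 by auto
  have "dY u w \<le> 2" "dY w v \<le> 2" using uwv dX_le_3[of u w] dX_le_3[of w v] by linarith+
  then obtain a b where a: "(Y w - Y u) mod n = a mod n" "\<bar>a\<bar> \<le> 2"
    and b: "(Y v - Y w) mod n = b mod n" "\<bar>b\<bar> \<le> 2"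
    using oriented_mod uwv by metis
  have ab: "(Y v - Y u) mod n = (a + b) mod n"
    using mod_add_cong[OF a(1) b(1)] by (simp add: add.commute)
  have "\<bar>a + b\<bar> \<le> 4" using a(2) b(2) by linarith
  moreover have "2 * x \<le> n" if "x \<le> 4" for x using that n12 by simp
  ultimately have "cyc_norm n (a + b) = \<bar>a + b\<bar>" using n_pos by (intro cyc_norm_small)
  then have dYab: "dY u v = \<bar>a + b\<bar>"
    using cyc_norm_cong[OF ab] d_commute(2)[of u v] by (simp add: dY_def)
  have big: "\<not> dY u v \<le> h - 4" using short_xpair[of u v] uwv by auto
  then have h7: "h \<le> 7" using dYab a b by linarith
  have "dY u v \<ge> 3" using big h6 by simp
  then consider "a + b = 3" | "a = 2" "b = 2" | "a + b = - 3" | "a = - 2" "b = - 2"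
    using dYab a b by linarith
  then show thesis
  proof cases
    case 1
    then show thesis using lev_nonzero[of u u 0] lev_nonzero[OF _ ab] uwv h7 by (intro three[of "Y u"]) simp_all
  next
    case 2
    then show thesis
      using lev_nonzero[of u u 0] lev_nonzero[OF _ a(1)] lev_nonzero[OF _ ab] uwv h7
      by (intro two_two[of "Y u"]) simp_all
  next
    case 3
    have "(Y u - Y v) mod n = 3 mod n" using mod_minus_cong[OF ab] 3 by simp
    then show thesis using lev_nonzero[of v v 0] lev_nonzero[of u v 3] uwv h7 by (intro three[of "Y v"]) simp_all
  next
    case 4
    have "(Y u - Y v) mod n = 4 mod n" "(Y w - Y v) mod n = 2 mod n"
      using mod_minus_cong[OF ab] mod_minus_cong[OF b(1)] 4 by simp_all
    then show thesis
      using lev_nonzero[of v v 0] lev_nonzero[of u v 4] lev_nonzero[of w v 2] uwv h7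
      by (intro two_two[of "Y v"]) simp_all
  qed
qed

lemma level_diff:
  assumes "p \<in> arc k 1" "q \<in> arc l 1"
  shows "(Y q - Y p) mod n = (l - k) mod n"
proof -
  have "n dvd Y q - l" "n dvd Y p - k" using arc_1[OF assms(1)] arc_1[OF assms(2)] by auto
  then have "n dvd (Y q - l) - (Y p - k)" by (rule dvd_diff)
  then show ?thesis by (simp add: mod_eq_dvd_iff algebra_simps)
qed

lemma xclique_arc_3: "xclique (arc y 3)"
  unfolding xclique_def
proof (intro conjI ballI impI)
  show "arc y 3 \<subseteq> S" by (rule arc_subset)
  fix p q assume pq: "p \<in> arc y 3" "q \<in> arc y 3" "p \<noteq> q"
  have "0 \<le> (Y p - y) mod n" "0 \<le> (Y q - y) mod n" using n_pos by simp_all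
  moreover have "(Y p - y) mod n < 3" "(Y q - y) mod n < 3" using pq by (auto simp: arc_def)
  moreover have "\<bar>a - b\<bar> \<le> 2" if "0 \<le> a" "0 \<le> b" "a < 3" "b < 3" for a b :: int
    using that by linarith
  ultimately have "dY p q \<le> 2"
    using dY_in_arc[OF pq(1,2)] n12 by simp
  then show "dY p q < dX p q" using close_xpair pq level_in_S by blast
qed

lemma window: "lev k + lev (k + 1) + lev (k + 2) \<le> 3"
  using xclique_card_le_3[OF xclique_arc_3[of k]] by (simp add: card_arc_3)

text \<open>
  Points whose levels are at least 3 apart form a Y-pair, since distances in \<open>C\<^sub>7\<close> are at most 3.
\<close>
lemma wide_spread:
  assumes "lev k \<noteq> 0" "lev (k + s) \<noteq> 0" "3 \<le> s" "s \<le> h - 2"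
  shows "7 \<le> card (arc (k - 2) (s + 5))"
proof -
  obtain p where p: "p \<in> arc k 1" by (rule lev_pos_obtain[OF assms(1)])
  obtain q where q: "q \<in> arc (k + s) 1" by (rule lev_pos_obtain[OF assms(2)])
  have "7 \<le> card (arc (Y p - 2) (s + 5))"
    using ypair_neighbourhood[of p q s] level_diff[OF p q] level_in_S[OF p] level_in_S[OF q]
      dX_le_3[of p q] assms by simp
  moreover have "(Y p - 2) mod n = (k - 2) mod n"
    using arc_1[OF p] by (simp add: mod_eq_dvd_iff dvd_eq_mod_eq_0)
  ultimately show ?thesis using arc_cong[of "Y p - 2" "k - 2" "s + 5"] by simp
qed

lemma level_profile: "level_profile n h (\<lambda>i. lev (k + i))"
proof
  fix i j s t :: int
  show "lev (k + (i + n)) = lev (k + i)" using lev_add_period[of "k + i"] by (simp add: add.assoc)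
  show "lev (k + i) + lev (k + (i + 1)) + lev (k + (i + 2)) \<le> 3"
    using window[of "k + i"] by (simp add: add.assoc)
  show "lev (k + t) = 0 \<or> lev (k + (t + i)) = 0 \<or> lev (k + (t + i + j)) = 0"
    if "3 \<le> i" "3 \<le> j" "i + j \<le> h"
  proof (rule ccontr)
    assume "\<not> ?thesis"
    then have ne: "lev (k + t) \<noteq> 0" "lev (k + (t + i)) \<noteq> 0" "lev (k + (t + i + j)) \<noteq> 0"
      by simp_all
    obtain p where p: "p \<in> arc (k + t) 1" by (rule lev_pos_obtain[OF ne(1)])
    obtain q where q: "q \<in> arc (k + (t + i)) 1" by (rule lev_pos_obtain[OF ne(2)])
    obtain r where r: "r \<in> arc (k + (t + i + j)) 1" by (rule lev_pos_obtain[OF ne(3)])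
    show False
      using no_chain[of p q r i j] level_diff[OF p q] level_diff[OF q r] dX_le_3[of p q]
        dX_le_3[of q r] level_in_S[OF p] level_in_S[OF q] level_in_S[OF r] that h_bounds by simp
  qed
  show "lev (k + t) = 0 \<or> lev (k + (t + s)) = 0" if "3 \<le> s" "s \<le> h - 4"
  proof (rule ccontr)
    assume "\<not> ?thesis"
    then have ne: "lev (k + t) \<noteq> 0" "lev (k + (t + s)) \<noteq> 0" by simp_all
    obtain p where p: "p \<in> arc (k + t) 1" by (rule lev_pos_obtain[OF ne(1)])
    obtain q where q: "q \<in> arc (k + (t + s)) 1" by (rule lev_pos_obtain[OF ne(2)])
    show False
      using short_ypair_free[of p q s] level_diff[OF p q] dX_le_3[of p q]
        level_in_S[OF p] level_in_S[OF q] that by simp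
  qed
  show "lev (k + (i - 2)) \<noteq> 0 \<and> lev (k + (i + (h - 1))) \<noteq> 0"
    if "lev (k + i) \<noteq> 0" "lev (k + (i + (h - 3))) \<noteq> 0"
  proof -
    define y where "y = k + i - 2"
    have "7 \<le> card (arc y (h + 2))"
      using wide_spread[of "k + i" "h - 3"] that h6 by (simp add: y_def algebra_simps)
    moreover have "card (arc y (h + 2)) = card (arc y (h + 1)) + lev (y + (h + 1))"
      using card_arc_add[of "h + 1" 1 y] h6 h_bounds n12 by (simp add: lev_def add.assoc)
    moreover have "card (arc y (h + 2)) = lev y + card (arc (y + 1) (h + 1))"
      using card_arc_add[of 1 "h + 1" y] h6 h_bounds n12 by (simp add: lev_def algebra_simps)
    moreover have "card (arc y (h + 1)) \<le> 6" "card (arc (y + 1) (h + 1)) \<le> 6"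
      using h_bounds by (intro half_arc_card_le_6; simp)+
    ultimately have "lev y \<noteq> 0" "lev (y + (h + 1)) \<noteq> 0" by linarith+
    then show ?thesis by (simp add: y_def algebra_simps)
  qed
  show "lev (k + (i + 1)) \<noteq> 0 \<or> lev (k + (i + 2)) \<noteq> 0"
    if "h = 6" "lev (k + i) \<noteq> 0" "lev (k + (i + 3)) \<noteq> 0"
  proof -
    define y where "y = k + i - 2"
    have "7 \<le> card (arc y 8)"
      using wide_spread[of "k + i" 3] that by (simp add: y_def algebra_simps)
    moreover have "card (arc y 8) = card (arc y 3) + card (arc (y + 3) 5)"
      using card_arc_add[of 3 5 y] n12 by simp
    moreover have "card (arc (y + 3) 5) = card (arc (y + 3) 2) + card (arc (y + 5) 3)"
      using card_arc_add[of 2 3 "y + 3"] n12 by (simp add: add.assoc)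
    moreover have "card (arc y 3) \<le> 3" "card (arc (y + 5) 3) \<le> 3"
      by (intro xclique_card_le_3 xclique_arc_3)+
    moreover have "card (arc (y + 3) 2) = lev (k + (i + 1)) + lev (k + (i + 2))"
      using card_arc_2[of "y + 3"] n12 by (simp add: y_def algebra_simps)
    ultimately show ?thesis by linarith
  qed
  show "(\<Sum>i<nat n. lev (k + int i)) = 10"
    using card_eq_sum_lev[of k] card10 by simp
qed

lemma dX_two_levels:
  assumes "p \<in> arc y 1" "q \<in> arc (y + 2) 1"
  shows "dX p q = 3" "dX q p = 3"
proof -
  have "dY p q = 2" using dY_levels[OF assms] cyc_norm_small[OF n_pos, of "- 2"] n12 by simp
  moreover from this have "p \<noteq> q" by auto
  ultimately have "2 < dX p q" using close_xpair[of p q] level_in_S assms by auto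
  then show "dX p q = 3" "dX q p = 3" using dX_le_3[of p q] d_commute[of p q] by simp_all
qed

lemma dX_one_level:
  assumes "p \<in> arc y 1" "q \<in> arc (y + 1) 1"
  shows "dX p q > 1"
proof -
  have "dY p q = 1" using dY_levels[OF assms] cyc_norm_small[OF n_pos, of "- 1"] n12 by simp
  moreover from this have "p \<noteq> q" by auto
  ultimately show ?thesis using close_xpair[of p q] level_in_S assms by auto
qed

lemma lev_2_obtain:
  assumes "lev y = 2"
  obtains q q' where "q \<in> arc y 1" "q' \<in> arc y 1" "dX q q' > 0"
proof -
  obtain q q' where q: "arc y 1 = {q, q'}" "q \<noteq> q'" using assms by (auto simp: lev_def card_2_iff)
  then show thesis using dX_pos_same_level[of q y q'] by (intro that[of q q']) auto
qed

text \<open>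
  Both points are opposite to the pair between them.
\<close>
lemma same_X_across_pair:
  assumes "a \<in> arc y 1" "lev (y + 2) = 2" "b \<in> arc (y + 4) 1"
  shows "X a mod 7 = X b mod 7"
proof -
  obtain q q' where q: "q \<in> arc (y + 2) 1" "q' \<in> arc (y + 2) 1" "dX q q' > 0"
    by (rule lev_2_obtain[OF assms(2)])
  have b: "b \<in> arc (y + 2 + 2) 1" using assms(3) by (simp add: add.assoc)
  have "dX q a = 3" "dX q' a = 3" "dX q b = 3" "dX q' b = 3"
    using dX_two_levels[OF assms(1) q(1)] dX_two_levels[OF assms(1) q(2)]
      dX_two_levels[OF q(1) b] dX_two_levels[OF q(2) b] by simp_all
  then show ?thesis
    using equidistant_pair_mod_7[of "X q" "X a" "X q'"] equidistant_pair_mod_7[of "X q" "X b" "X q'"] q(3)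
    by (simp add: dX_def)
qed

text \<open>
  The levels \<open>k\<close>, \<open>k + 2\<close>, \<dots>, \<open>k + 12\<close> are indexed cyclically by \<open>l\<close>. For 14 levels every step of \<open>l\<close> passes
  two levels; for 13 levels the step from \<open>k + 12\<close> back to \<open>k\<close> passes only one. The numbers of points are
  \<open>1, 2, 1, 2, 1, 2, 1\<close> from some index \<open>j\<close> on. Passing a pair does not change the first coordinate of a
  single point, except by at most 1 if the exceptional step is involved. So the first and the last
  single point are at distance at most 1 in \<open>C\<^sub>7\<close>, and even coincide there if the exceptional step
  is the one between them, whereas they form an X-pair with distance at least 2, and 3 unless their
  step is the exceptional one.
\<close>
lemma no_seven_cycle:
  assumes n: "n = 13 \<or> n = 14"
    and ten: "lev k + lev (k + 2) + lev (k + 4) + lev (k + 6) + lev (k + 8) + lev (k + 10) + lev (k + 12) = 10"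
  shows False
proof -
  define l where "l i = k + 2 * (i mod 7)" for i :: int
  have l_per: "l (i + 7) = l i" for i by (simp add: l_def)
  have next_mod: "(i + 1) mod 7 = (if i mod 7 = 6 then 0 else i mod 7 + 1)" for i :: int
    by (cases i rule: residue_7_cases) (simp_all add: mod_add_left_eq[of i 7 1, symmetric])
  have l_next: "l (i + 1) = l i + 2" if "i mod 7 \<noteq> 6" for i
    using that next_mod[of i] by (simp add: l_def)
  have l_wrap: "l i = k + 12" "l (i + 1) = k" if "i mod 7 = 6" for i
    using that next_mod[of i] by (simp_all add: l_def)
  have lev_le: "lev (l i) + lev (l (i + 1)) \<le> 3" for i
  proof (cases "i mod 7 = 6")
    case False
    then show ?thesis using window[of "l i"] l_next by simp
  next
    case True
    have "lev k = lev (k + 13) \<or> lev k = lev (k + 14)"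
      using n lev_add_period[of k] by auto
    moreover have "lev (k + 12) + lev (k + 13) + lev (k + 14) \<le> 3"
      using window[of "k + 12"] by (simp add: add.assoc)
    ultimately show ?thesis unfolding l_wrap[OF True] by linarith
  qed
  have clean: "dX p q = 3" if "i mod 7 \<noteq> 6" "p \<in> arc (l i) 1" "q \<in> arc (l (i + 1)) 1" for i p q
    using dX_two_levels[of p "l i" q] that l_next by simp
  have link: "dX p q > 1" if pq: "p \<in> arc (l i) 1" "q \<in> arc (l (i + 1)) 1" for i p q
  proof (cases "i mod 7 = 6")
    case False
    then show ?thesis using clean[OF False pq] by simp
  next
    case True
    have "arc (k + c) 1 = arc k 1" if "n = c" for c
      by (rule arc_cong) (simp only: that[symmetric] mod_add_self2)
    from this[of 13] this[of 14] n have "arc (k + 13) 1 = arc k 1 \<or> arc (k + 14) 1 = arc k 1"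
      by metis
    then have "arc k 1 = arc (k + 12 + 1) 1 \<or> arc k 1 = arc (k + 12 + 2) 1"
      by (elim disjE) (simp_all add: add.assoc)
    then show ?thesis
      using pq dX_one_level[of p "k + 12" q] dX_two_levels[of p "k + 12" q]
      unfolding l_wrap[OF True] by auto
  qed
  obtain j where j: "0 \<le> j" "j < 7" "lev (l j) = 1" "lev (l (j + 1)) = 2" "lev (l (j + 2)) = 1"
    "lev (l (j + 3)) = 2" "lev (l (j + 4)) = 1" "lev (l (j + 5)) = 2" "lev (l (j + 6)) = 1"
  proof (rule pattern_1212121[of "\<lambda>i. lev (l i)"])
    show "lev (l 0) + lev (l 1) + lev (l 2) + lev (l 3) + lev (l 4) + lev (l 5) + lev (l 6) = 10"
      using ten by (simp add: l_def)
  qed (use l_per lev_le that in auto)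
  have pass: "dX a b \<le> 1 \<and> (i mod 7 \<noteq> 6 \<longrightarrow> (i + 1) mod 7 \<noteq> 6 \<longrightarrow> dX a b = 0)"
    if two: "lev (l (i + 1)) = 2" and a: "a \<in> arc (l i) 1" and b: "b \<in> arc (l (i + 2)) 1" for i a b
  proof -
    obtain q q' where q: "q \<in> arc (l (i + 1)) 1" "q' \<in> arc (l (i + 1)) 1" "dX q q' > 0"
      by (rule lev_2_obtain[OF two])
    have b': "b \<in> arc (l (i + 1 + 1)) 1" using b by (simp add: add.assoc)
    have 1: "dX a q > 1" "dX a q' > 1" "dX b q > 1" "dX b q' > 1"
      using link[OF a q(1)] link[OF a q(2)] link[OF q(1) b'] link[OF q(2) b'] d_commute by simp_all
    have a2: "dX a q = 3 \<and> dX a q' = 3" if "i mod 7 \<noteq> 6"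
      using clean[OF that a q(1)] clean[OF that a q(2)] by simp
    have b2: "dX b q = 3 \<and> dX b q' = 3" if "(i + 1) mod 7 \<noteq> 6"
      using clean[OF that q(1) b'] clean[OF that q(2) b'] d_commute by simp
    have "dX a b \<le> 1"
    proof (cases "i mod 7 = 6")
      case False
      then show ?thesis using 1 a2 q(3) pass_mod_7[of "X a" "X q" "X q'" "X b"] by (simp add: dX_def)
    next
      case True
      then have "(i + 1) mod 7 \<noteq> 6" using next_mod[of i] by simp
      then have "dX b a \<le> 1"
        using 1 b2 q(3) pass_mod_7[of "X b" "X q" "X q'" "X a"] by (simp add: dX_def)
      then show ?thesis by (simp add: d_commute)
    qed
    moreover have "dX a b = 0" if "i mod 7 \<noteq> 6" "(i + 1) mod 7 \<noteq> 6"
    proof -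
      have mid: "X e mod 7 = (4 * (X q + X q')) mod 7" if "dX e q = 3" "dX e q' = 3" for e
        using that q(3) d_commute(1)[of e q] d_commute(1)[of e q']
        by (intro equidistant_pair_mod_7) (simp_all add: dX_def)
      show ?thesis using mid[of a] mid[of b] a2[OF that(1)] b2[OF that(2)] by (simp add: dX_eq_0_iff)
    qed
    ultimately show ?thesis by blast
  qed
  have ne: "lev (l j) \<noteq> 0" "lev (l (j + 2)) \<noteq> 0" "lev (l (j + 4)) \<noteq> 0" "lev (l (j + 6)) \<noteq> 0"
    using j by simp_all
  obtain a where a: "a \<in> arc (l j) 1" by (rule lev_pos_obtain[OF ne(1)])
  obtain b where b: "b \<in> arc (l (j + 2)) 1" by (rule lev_pos_obtain[OF ne(2)])
  obtain c where c: "c \<in> arc (l (j + 4)) 1" by (rule lev_pos_obtain[OF ne(3)])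
  obtain d where d: "d \<in> arc (l (j + 6)) 1" by (rule lev_pos_obtain[OF ne(4)])
  have a': "a \<in> arc (l (j + 6 + 1)) 1" using a l_per[of j] by (simp add: add.assoc)
  have p1: "dX a b \<le> 1 \<and> (j mod 7 \<noteq> 6 \<longrightarrow> (j + 1) mod 7 \<noteq> 6 \<longrightarrow> dX a b = 0)"
    using pass[of j a b] a b j by simp
  have p2: "dX b c \<le> 1 \<and> ((j + 2) mod 7 \<noteq> 6 \<longrightarrow> (j + 3) mod 7 \<noteq> 6 \<longrightarrow> dX b c = 0)"
    using pass[of "j + 2" b c] b c j by (simp add: add.assoc)
  have p3: "dX c d \<le> 1 \<and> ((j + 4) mod 7 \<noteq> 6 \<longrightarrow> (j + 5) mod 7 \<noteq> 6 \<longrightarrow> dX c d = 0)"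
    using pass[of "j + 4" c d] c d j by (simp add: add.assoc)
  have far: "dX d a > 1 \<and> ((j + 6) mod 7 \<noteq> 6 \<longrightarrow> dX d a = 3)"
    using link[OF d a'] clean[OF _ d a'] by simp
  have tri: "dX d a \<le> dX a b + dX b c + dX c d"
    using dX_triangle[of a c b] dX_triangle[of a d c] d_commute(1)[of d a] by simp
  have "j = 0 \<or> j = 1 \<or> j = 2 \<or> j = 3 \<or> j = 4 \<or> j = 5 \<or> j = 6" using j(1,2) by linarith
  then show False using p1 p2 p3 far tri by (elim disjE) simp_all
qed

text \<open>
  The four single points of the block turn by 2 at each level in a fixed direction, hence by 6 in
  total, and the first and the last of them are neighbours in \<open>C\<^sub>7\<close>. On the other way round there are
  four levels with one or two points each and six points in total. Two of them are pairs and preserve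
  the first coordinate, and one step of distance 3 remains.
\<close>
lemma no_block_of_four:
  assumes n: "n = 13"
    and one: "lev k = 1" "lev (k + 1) = 1" "lev (k + 2) = 1" "lev (k + 3) = 1"
    and six: "lev (k + 5) + lev (k + 7) + lev (k + 9) + lev (k + 11) = 6"
  shows False
proof -
  obtain p0 where p0: "p0 \<in> arc k 1" by (rule lev_pos_obtain[of k]) (simp add: one)
  obtain p1 where p1: "p1 \<in> arc (k + 1) 1" by (rule lev_pos_obtain[of "k + 1"]) (simp add: one)
  obtain p2 where p2: "p2 \<in> arc (k + 2) 1" by (rule lev_pos_obtain[of "k + 2"]) (simp add: one)
  obtain p3 where p3: "p3 \<in> arc (k + 3) 1" by (rule lev_pos_obtain[of "k + 3"]) (simp add: one)
  define z where "z = X p1 - X p0"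
  have d1: "dX p0 p1 > 1" "dX p1 p2 > 1" "dX p2 p3 > 1"
    using dX_one_level[OF p0 p1] dX_one_level[of p1 "k + 1" p2] dX_one_level[of p2 "k + 2" p3] p1 p2 p3
    by (simp_all add: add.assoc)
  have d2: "dX p0 p2 > 2" "dX p1 p3 > 2"
    using dX_two_levels(1)[OF p0 p2] dX_two_levels(1)[of p1 "k + 1" p3] p1 p3 by (simp_all add: add.assoc)
  have c: "cyc_norm 7 (X q - X p) = dX p q" for p q
    by (simp add: dX_def cyc_norm_diff_commute)
  have t1: "(X p2 - X p1) mod 7 = z mod 7"
    using equal_turns_mod_7[of "X p2 - X p1" z] d1 d2 by (simp add: z_def c)
  have t2: "(X p3 - X p2) mod 7 = z mod 7"
    using equal_turns_mod_7[of "X p3 - X p2" "X p2 - X p1"] d1 d2 t1 by (simp add: c)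
  have "(X p2 - X p1 + (X p1 - X p0)) mod 7 = (z + z) mod 7"
    using t1 by (intro mod_add_cong) (simp_all add: z_def)
  from cyc_norm_cong[OF this] have "cyc_norm 7 (z + z) > 2" using d2(1) c[of p2 p0] by simp
  moreover have "cyc_norm 7 z > 1" using d1 by (simp add: z_def c)
  ultimately have "cyc_norm 7 (z + z + z) \<le> 1"
    unfolding cyc_norm_7 mod_add_eq[of "z + z" 7 z, symmetric] mod_add_eq[of z 7 z, symmetric]
    by (cases z rule: residue_7_cases) simp_all
  moreover have "(X p3 - X p0) mod 7 = (z + z + z) mod 7"
  proof -
    have "(X p3 - X p2 + (X p2 - X p1) + (X p1 - X p0)) mod 7 = (z + z + z) mod 7"
      using t1 t2 by (intro mod_add_cong) (simp_all add: z_def)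
    then show ?thesis by simp
  qed
  ultimately have near: "dX p0 p3 \<le> 1" using cyc_norm_cong[of "X p3 - X p0" 7 "z + z + z"] c[of p3 p0] by simp
  have p0': "p0 \<in> arc (k + 13) 1" using p0 n arc_add_period[of k 1] by simp
  have w: "lev (k + 3) + lev (k + 5) \<le> 3" "lev (k + 5) + lev (k + 7) \<le> 3"
    "lev (k + 7) + lev (k + 9) \<le> 3" "lev (k + 9) + lev (k + 11) \<le> 3" "lev (k + 11) + lev k \<le> 3"
    using window[of "k + 3"] window[of "k + 5"] window[of "k + 7"] window[of "k + 9"] window[of "k + 11"]
      n lev_add_period[of k] by (simp_all add: add.assoc)
  have ne: "lev (k + 5) \<noteq> 0" "lev (k + 7) \<noteq> 0" "lev (k + 9) \<noteq> 0" "lev (k + 11) \<noteq> 0"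
    using w one six by linarith+
  obtain a where a: "a \<in> arc (k + 5) 1" by (rule lev_pos_obtain[OF ne(1)])
  obtain b where b: "b \<in> arc (k + 7) 1" by (rule lev_pos_obtain[OF ne(2)])
  obtain c where c: "c \<in> arc (k + 9) 1" by (rule lev_pos_obtain[OF ne(3)])
  obtain d where d: "d \<in> arc (k + 11) 1" by (rule lev_pos_obtain[OF ne(4)])
  have pass: "lev (k + 5) = 2 \<Longrightarrow> X p3 mod 7 = X b mod 7" "lev (k + 7) = 2 \<Longrightarrow> X a mod 7 = X c mod 7"
    "lev (k + 9) = 2 \<Longrightarrow> X b mod 7 = X d mod 7" "lev (k + 11) = 2 \<Longrightarrow> X c mod 7 = X p0 mod 7"
    using same_X_across_pair[of p3 "k + 3" b] same_X_across_pair[of a "k + 5" c]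
      same_X_across_pair[of b "k + 7" d] same_X_across_pair[of c "k + 9" p0] p3 a b c d p0'
    by (simp_all add: add.assoc)
  have link: "dX p3 a = 3" "dX b c = 3" "dX d p0 = 3"
    using dX_two_levels(1)[of p3 "k + 3" a] dX_two_levels(1)[of b "k + 7" c]
      dX_two_levels(1)[of d "k + 11" p0] p3 a b c d p0' by (simp_all add: add.assoc)
  have same: "dX p q = dX p' q'" if "X p mod 7 = X p' mod 7" "X q mod 7 = X q' mod 7" for p q p' q'
    unfolding dX_def using mod_diff_cong[OF that] by (rule cyc_norm_cong)
  consider "lev (k + 7) = 2" "lev (k + 11) = 2" | "lev (k + 5) = 2" "lev (k + 9) = 2"
    | "lev (k + 5) = 2" "lev (k + 11) = 2"
    using w one six by linarith
  then have "dX p3 p0 = 3"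
  proof cases
    case 1
    then show ?thesis using same[of p3 p3 a p0] pass link by simp
  next
    case 2
    then show ?thesis using same[of d p3 p0 p0] pass link by simp
  next
    case 3
    then show ?thesis using same[of b p3 c p0] pass link by simp
  qed
  then show False using near by (simp add: d_commute)
qed

text \<open>
  The base level of the profile is chosen so that its levels 0 and 3, or 0, 2 and 4, are occupied;
  in the second case there are no occupied levels at distance 3 at all.
\<close>
lemma contradiction: False
proof -
  have three: False if k: "lev k \<noteq> 0" "lev (k + 3) \<noteq> 0" and h7: "h \<le> 7" for k
  proof -
    interpret P: level_profile n h "\<lambda>i. lev (k + i)" by (rule level_profile)
    have "h \<noteq> 7" using P.near[of 3 0] k by auto
    then have h: "h = 6" using h6 h7 by simp
    then consider "n = 12" | "n = 13" using h_cases by linarith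
    then show False
    proof cases
      case 1
      then show False using P.no_gap_3_if_12 h k by simp
    next
      case 2
      obtain j where "lev (k + j) + lev (k + (j + 2)) + lev (k + (j + 4)) + lev (k + (j + 6)) +
          lev (k + (j + 8)) + lev (k + (j + 10)) + lev (k + (j + 12)) = 10 \<or>
        lev (k + j) = 1 \<and> lev (k + (j + 1)) = 1 \<and> lev (k + (j + 2)) = 1 \<and> lev (k + (j + 3)) = 1 \<and>
        lev (k + (j + 5)) + lev (k + (j + 7)) + lev (k + (j + 9)) + lev (k + (j + 11)) = 6"
        using P.gap_3_if_13[OF 2 h] k by auto
      then show False
        using no_seven_cycle[of "k + j"] no_block_of_four[of "k + j"] 2 by (auto simp: add.assoc)
    qed
  qed
  show False
  proof (rule obtain_close_levels)
    fix k assume "lev k \<noteq> 0" "lev (k + 3) \<noteq> 0" "h \<le> 7"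
    then show False by (rule three)
  next
    fix k assume k: "lev k \<noteq> 0" "lev (k + 2) \<noteq> 0" "lev (k + 4) \<noteq> 0" and h7: "h \<le> 7"
    interpret P: level_profile n h "\<lambda>i. lev (k + i)" by (rule level_profile)
    have gap: "lev (k + i) = 0 \<or> lev (k + (i + 3)) = 0" for i
      using three[of "k + i"] h7 by (auto simp: add.assoc)
    have "h = 6 \<or> h = 7" using h6 h7 by linarith
    then consider "n = 12" "h = 6" | "n = 13" "h = 6" | "n = 14" "h = 7" | "n = 15" "h = 7"
      using h_cases by linarith
    then show False
    proof cases
      case 1 then show False using P.no_even_run_if_12 k gap by simp
    next
      case 2 then show False using P.no_even_run_if_13 k gap by simp
    next
      case 3 then show False using P.even_run_if_14 k no_seven_cycle[of k] by simp
    next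
      case 4 then show False using P.no_even_run_if_15 k by simp
    qed
  qed
qed

end

section \<open>Distances in the strong product of two cycles\<close>


text \<open>
  A function is the distance from \<open>u\<close> to \<open>v\<close> if it vanishes on the diagonal, decreases by at most 1 along
  an arc, and does decrease along some arc as long as \<open>v\<close> is not reached.
\<close>
lemma gdist_eqI:
  fixes D :: "'a \<Rightarrow> 'a \<Rightarrow> nat"
  assumes G: "pair_graph G"
    and refl: "\<And>v. D v v = 0"
    and arc: "\<And>u v w. (u, w) \<in> parcs G \<Longrightarrow> v \<in> pverts G \<Longrightarrow> D u v \<le> Suc (D w v)"
    and descent: "\<And>u v. u \<in> pverts G \<Longrightarrow> v \<in> pverts G \<Longrightarrow> u \<noteq> v \<Longrightarrow>
      \<exists>w. (u, w) \<in> parcs G \<and> D u v = Suc (D w v)"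
    and uv: "u \<in> pverts G" "v \<in> pverts G"
  shows "gdist G u v = ereal (real (D u v))"
proof -
  interpret pair_graph G by fact
  have cost: "awalk_cost (\<lambda>_. 1) p = real (length p)" for p
    by (induction p) auto
  have lower: "D x v \<le> length p" if "awalk x p v" for x p
    using that
  proof (induction p arbitrary: x)
    case Nil
    then show ?case by (simp add: awalk_Nil_iff refl)
  next
    case (Cons e p)
    then have "e \<in> parcs G" "x = fst e" "awalk (snd e) p v" by (auto simp: awalk_Cons_iff)
    then show ?case using Cons.IH[of "snd e"] arc[of x "snd e" v] uv(2) by fastforce
  qed
  have upper: "\<exists>p. awalk x p v \<and> length p = D x v" if "x \<in> pverts G" for x
    using that
  proof (induction "D x v" arbitrary: x)
    case 0
    then have "x = v" using descent[of x v] uv(2) by fastforce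
    then show ?case using 0 by (intro exI[of _ "[]"]) (simp add: awalk_Nil_iff)
  next
    case (Suc k)
    then have "x \<noteq> v" using refl by auto
    then obtain w where w: "(x, w) \<in> parcs G" "D x v = Suc (D w v)"
      using descent[of x v] Suc.prems uv(2) by blast
    then have "w \<in> pverts G" by (auto dest: in_arcsD2)
    then obtain p where "awalk w p v" "length p = D w v" using Suc w by auto
    then show ?case using w by (intro exI[of _ "(x, w) # p"]) (simp add: awalk_Cons_iff)
  qed
  obtain p where p: "awalk u p v" "length p = D u v" using upper uv(1) by blast
  have "gdist G u v \<le> ereal (real (D u v))"
    using min_cost_le_walk_cost[OF p(1), of "\<lambda>_. 1"] p(2) by (simp add: gdist_def cost)
  moreover have "ereal (real (D u v)) \<le> gdist G u v"
    unfolding gdist_def \<mu>_def using lower by (intro INF_greatest) (auto simp: cost)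
  ultimately show ?thesis by (rule antisym)
qed

lemma cycle_arc_norm:
  assumes "(u, w) \<in> parcs (cycle_graph m)" "m \<ge> 3"
  shows "cyc_norm (int m) (int u - int w) \<le> 1"
proof -
  consider "w = (u + 1) mod m" | "u = (w + 1) mod m"
    using assms(1) by (auto simp: cycle_graph_def)
  then have "(int u - int w) mod int m = (- 1) mod int m \<or> (int u - int w) mod int m = 1 mod int m"
  proof cases
    case 1
    then have "int w = (int u + 1) mod int m" by (simp add: zmod_int add.commute)
    then show ?thesis by (simp add: mod_diff_right_eq)
  next
    case 2
    then have "int u = (int w + 1) mod int m" by (simp add: zmod_int add.commute)
    then show ?thesis by (simp add: mod_diff_left_eq)
  qed
  then have "cyc_norm (int m) (int u - int w) = cyc_norm (int m) 1"
    using cyc_norm_cong cyc_norm_minus by metis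
  then show ?thesis using cyc_norm_le_abs[of "int m" 1] assms(2) by simp
qed

lemma cycle_step_norm:
  assumes "u < m" "v < m" "u \<noteq> v"
  obtains w where "(u, w) \<in> parcs (cycle_graph m)" "w < m"
    "cyc_norm (int m) (int w - int v) = cyc_norm (int m) (int u - int v) - 1"
proof -
  have m: "int m > 0" using assms by simp
  have "\<not> int m dvd int u - int v"
  proof
    assume "int m dvd int u - int v"
    then have "int u mod int m = int v mod int m" by (simp add: mod_eq_dvd_iff)
    then show False using assms by simp
  qed
  then have "cyc_norm (int m) (int u - int v) > 0"
    using cyc_norm_eq_0_iff[OF m] cyc_norm_nonneg[OF m] by (metis order_le_less)
  then obtain e where e: "e = 1 \<or> e = - 1"
    "cyc_norm (int m) (int u - int v + e) = cyc_norm (int m) (int u - int v) - 1"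
    by (rule cyc_norm_step[OF m])
  define w where "w = nat ((int u + e) mod int m)"
  have w: "int w = (int u + e) mod int m" using m by (simp add: w_def)
  have "(int w - int v) mod int m = (int u - int v + e) mod int m"
    unfolding w by (simp add: mod_diff_left_eq algebra_simps)
  then have norm: "cyc_norm (int m) (int w - int v) = cyc_norm (int m) (int u - int v) - 1"
    using e(2) cyc_norm_cong by metis
  have wm: "w < m" using w m by (metis of_nat_less_iff pos_mod_bound)
  have "w = (u + 1) mod m \<or> u = (w + 1) mod m"
    using e(1)
  proof
    assume "e = 1"
    then have "int w = int ((u + 1) mod m)" by (simp add: w zmod_int add.commute)
    then show ?thesis by simp
  next
    assume "e = - 1"
    then have "int ((w + 1) mod m) = int u" using assms(1) by (simp add: w zmod_int mod_add_right_eq)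
    then show ?thesis by simp
  qed
  then have "(u, w) \<in> parcs (cycle_graph m)" using wm assms(1) by (simp add: cycle_graph_def)
  then show thesis using norm wm by (intro that)
qed

definition torus_dist :: "nat \<Rightarrow> nat \<Rightarrow> nat \<times> nat \<Rightarrow> nat \<times> nat \<Rightarrow> nat" where
  "torus_dist m n p q = nat (max (cyc_norm (int m) (int (fst p) - int (fst q)))
     (cyc_norm (int n) (int (snd p) - int (snd q))))"

lemma int_torus_dist:
  assumes "m > 0"
  shows "int (torus_dist m n p q) = max (cyc_norm (int m) (int (fst p) - int (fst q)))
     (cyc_norm (int n) (int (snd p) - int (snd q)))"
proof -
  have "0 \<le> cyc_norm (int m) (int (fst p) - int (fst q))" using assms by (simp add: cyc_norm_nonneg)
  then show ?thesis unfolding torus_dist_def by (intro int_nat_eq[THEN trans] if_P) simp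
qed

lemma pverts_torus: "pverts (cycle_graph m \<boxtimes> cycle_graph n) = {0..<m} \<times> {0..<n}"
  by (simp add: strong_product_def cycle_graph_def)

text \<open>
  A step that decreases both coordinate distances, or keeps a coordinate that is already correct,
  decreases their maximum.
\<close>
lemma gdist_torus:
  assumes m: "m \<ge> 3" and n: "n \<ge> 3"
    and p: "p \<in> {0..<m} \<times> {0..<n}" and q: "q \<in> {0..<m} \<times> {0..<n}"
  shows "gdist (cycle_graph m \<boxtimes> cycle_graph n) p q = ereal (real (torus_dist m n p q))"
proof (rule gdist_eqI)
  show "pair_graph (cycle_graph m \<boxtimes> cycle_graph n)"
    by (intro pair_graph_strong_product pair_graph_cycle_graph m n)
  have pos: "int m > 0" "int n > 0" using m n by auto
  note D = int_torus_dist[of m n]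
  show "torus_dist m n v v = 0" for v by (simp add: torus_dist_def cyc_norm_def)
  show "torus_dist m n u v \<le> Suc (torus_dist m n w v)"
    if "(u, w) \<in> parcs (cycle_graph m \<boxtimes> cycle_graph n)" for u v w
  proof -
    have "fst u = fst w \<or> (fst u, fst w) \<in> parcs (cycle_graph m)"
      and "snd u = snd w \<or> (snd u, snd w) \<in> parcs (cycle_graph n)"
      using that by (auto simp: strong_product_def)
    then have 1: "cyc_norm (int m) (int (fst u) - int (fst w)) \<le> 1"
      and 2: "cyc_norm (int n) (int (snd u) - int (snd w)) \<le> 1"
      using cycle_arc_norm m n by (auto simp: cyc_norm_def)
    have "cyc_norm (int m) (int (fst u) - int (fst v)) \<le> 1 + cyc_norm (int m) (int (fst w) - int (fst v))"
      using cyc_norm_triangle[OF pos(1), of "int (fst u) - int (fst w)" "int (fst w) - int (fst v)"] 1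
      by simp
    moreover have "cyc_norm (int n) (int (snd u) - int (snd v)) \<le> 1 + cyc_norm (int n) (int (snd w) - int (snd v))"
      using cyc_norm_triangle[OF pos(2), of "int (snd u) - int (snd w)" "int (snd w) - int (snd v)"] 2
      by simp
    ultimately have "int (torus_dist m n u v) \<le> 1 + int (torus_dist m n w v)"
      using D[of u v] D[of w v] pos by linarith
    then show ?thesis by simp
  qed
  show "\<exists>w. (u, w) \<in> parcs (cycle_graph m \<boxtimes> cycle_graph n) \<and>
      torus_dist m n u v = Suc (torus_dist m n w v)"
    if uv: "u \<in> pverts (cycle_graph m \<boxtimes> cycle_graph n)" "v \<in> pverts (cycle_graph m \<boxtimes> cycle_graph n)"
      "u \<noteq> v" for u v
  proof -
    obtain a b c d where ab: "u = (a, b)" "v = (c, d)" by (metis surj_pair)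
    have lt: "a < m" "b < n" "c < m" "d < n" using uv ab by (auto simp: pverts_torus)
    have V: "a \<in> pverts (cycle_graph m)" "b \<in> pverts (cycle_graph n)" using lt by (auto simp: cycle_graph_def)
    have z: "cyc_norm k 0 = 0" for k by (simp add: cyc_norm_def)
    have nn: "cyc_norm (int m) x \<ge> 0" "cyc_norm (int n) x \<ge> 0" for x
      using pos by (simp_all add: cyc_norm_nonneg)
    obtain a' where a': "a = c \<and> a' = a \<or> a \<noteq> c \<and> (a, a') \<in> parcs (cycle_graph m) \<and>
        cyc_norm (int m) (int a' - int c) = cyc_norm (int m) (int a - int c) - 1"
      using cycle_step_norm[of a m c] lt by metis
    obtain b' where b': "b = d \<and> b' = b \<or> b \<noteq> d \<and> (b, b') \<in> parcs (cycle_graph n) \<and>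
        cyc_norm (int n) (int b' - int d) = cyc_norm (int n) (int b - int d) - 1"
      using cycle_step_norm[of b n d] lt by metis
    have "(u, (a', b')) \<in> parcs (cycle_graph m \<boxtimes> cycle_graph n)"
      using a' b' uv(3) ab V by (auto simp: strong_product_def)
    moreover have "int (torus_dist m n u v) = 1 + int (torus_dist m n (a', b') v)"
      using a' b' uv(3) ab D[of u v] D[of "(a', b')" v] pos z
        nn(1)[of "int a' - int c"] nn(2)[of "int b' - int d"] by auto
    ultimately show ?thesis by (intro exI[of _ "(a', b')"]) auto
  qed
qed (use p q in \<open>simp_all add: pverts_torus\<close>)

definition torus_gp :: "nat \<Rightarrow> nat \<Rightarrow> (nat \<times> nat) set \<Rightarrow> bool" where
  "torus_gp m n S \<longleftrightarrow> (\<forall>u\<in>S. \<forall>v\<in>S. \<forall>w\<in>S. u \<noteq> v \<longrightarrow> w \<noteq> u \<longrightarrow> w \<noteq> v \<longrightarrow>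
     torus_dist m n u v \<noteq> torus_dist m n u w + torus_dist m n w v)"

lemma general_position_set_torus_iff:
  assumes "m \<ge> 3" "n \<ge> 3"
  shows "general_position_set (cycle_graph m \<boxtimes> cycle_graph n) S \<longleftrightarrow>
    S \<subseteq> {0..<m} \<times> {0..<n} \<and> torus_gp m n S"
proof -
  have "gdist (cycle_graph m \<boxtimes> cycle_graph n) u v \<noteq>
      gdist (cycle_graph m \<boxtimes> cycle_graph n) u w + gdist (cycle_graph m \<boxtimes> cycle_graph n) w v \<longleftrightarrow>
      torus_dist m n u v \<noteq> torus_dist m n u w + torus_dist m n w v"
    if "S \<subseteq> {0..<m} \<times> {0..<n}" "u \<in> S" "v \<in> S" "w \<in> S" for u v w
  proof -
    have "u \<in> {0..<m} \<times> {0..<n}" "v \<in> {0..<m} \<times> {0..<n}" "w \<in> {0..<m} \<times> {0..<n}"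
      using that by blast+
    then show ?thesis using gdist_torus[OF assms] by (simp flip: of_nat_add)
  qed
  moreover have "general_position_set (cycle_graph m \<boxtimes> cycle_graph n) S \<longleftrightarrow>
     S \<subseteq> pverts (cycle_graph m \<boxtimes> cycle_graph n) \<and>
     (\<forall>u\<in>S. \<forall>v\<in>S. \<forall>w\<in>S. u \<noteq> v \<longrightarrow> w \<noteq> u \<longrightarrow> w \<noteq> v \<longrightarrow>
        gdist (cycle_graph m \<boxtimes> cycle_graph n) u v \<noteq>
        gdist (cycle_graph m \<boxtimes> cycle_graph n) u w + gdist (cycle_graph m \<boxtimes> cycle_graph n) w v)"
    by (intro general_position_set_iff_gdist pair_graph_strong_product pair_graph_cycle_graph
        strongly_connected_strong_product strongly_connected_cycle_graph assms)
  ultimately show ?thesis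
    unfolding pverts_torus torus_gp_def by (metis (no_types, lifting))
qed

lemma gp_torus_of_torus_gp:
  assumes m: "m \<ge> 3" and n: "n \<ge> 3" and S: "S \<subseteq> {0..<m} \<times> {0..<n}" "torus_gp m n S"
  shows "gp_torus (int m) (int n) S (\<lambda>p. int (fst p)) (\<lambda>p. int (snd p))"
proof
  show "3 \<le> int m" "3 \<le> int n" using m n by auto
  show "finite S" using S(1) finite_subset by blast
  have pos: "int m > 0" "int n > 0" using m n by auto
  have eq: "a = b" if "cyc_norm (int k) (int a - int b) = 0" "a < k" "b < k" for a b k
  proof -
    have "int k dvd int a - int b" using that cyc_norm_eq_0_iff[of "int k"] by simp
    then have "int a mod int k = int b mod int k" by (simp only: mod_eq_dvd_iff)
    then show ?thesis using that by simp
  qed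
  show "cyc_norm (int m) (int (fst p) - int (fst q)) \<noteq> 0 \<or> cyc_norm (int n) (int (snd p) - int (snd q)) \<noteq> 0"
    if "p \<in> S" "q \<in> S" "p \<noteq> q" for p q
  proof -
    have "fst x < m \<and> snd x < n" if "x \<in> S" for x using subsetD[OF S(1) that] by (auto simp: mem_Times_iff)
    then show ?thesis
      using that eq[of m "fst p" "fst q"] eq[of n "snd p" "snd q"] by (auto simp: prod_eq_iff)
  qed
  show "max (cyc_norm (int m) (int (fst p) - int (fst q))) (cyc_norm (int n) (int (snd p) - int (snd q))) \<noteq>
      max (cyc_norm (int m) (int (fst p) - int (fst r))) (cyc_norm (int n) (int (snd p) - int (snd r))) +
      max (cyc_norm (int m) (int (fst r) - int (fst q))) (cyc_norm (int n) (int (snd r) - int (snd q)))"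
    if "p \<in> S" "q \<in> S" "r \<in> S" "p \<noteq> q" "r \<noteq> p" "r \<noteq> q" for p q r
    using S(2) that int_torus_dist[of m n] pos unfolding torus_gp_def
    by (metis of_nat_0_less_iff of_nat_add of_nat_eq_iff)
qed

section \<open>The general position number\<close>

context gp_torus_7
begin

lemma card_le:
  assumes "n \<noteq> 4"
  shows "card S \<le> (if n \<in> {7, 9, 11} then 10 else 9)"
proof -
  have sub: "gp_torus_7 n T X Y" if "T \<subseteq> S" for T
    using subset[OF that] by (simp add: gp_torus_7_def)
  have nine: "card S \<le> 9" if "\<And>T. T \<subseteq> S \<Longrightarrow> card T \<noteq> 10"
  proof (rule ccontr)
    assume "\<not> card S \<le> 9"
    then have "10 \<le> card S" by simp
    then obtain T where "T \<subseteq> S" "card T = 10" by (rule obtain_subset_with_card_n)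
    then show False using that by blast
  qed
  consider "n = 3 \<or> n = 6" | "n = 5" | "n = 7 \<or> n = 9" | "n = 8" | "n = 10" | "n = 11" | "n \<ge> 12"
    using n3 assms by linarith
  then show ?thesis
  proof cases
    case 1
    then show ?thesis using card_le_9_if_3_6 by auto
  next
    case 2
    have "card T \<noteq> 10" if "T \<subseteq> S" for T
    proof -
      have "gp_torus 7 5 T X Y" using subset[OF that] 2 by simp
      then have "gp_torus_5_7 T Y X" unfolding gp_torus_5_7_def by (rule gp_torus.swapped)
      then show ?thesis by (rule gp_torus_5_7.card_neq_10)
    qed
    then show ?thesis using nine 2 by simp
  next
    case 3
    then show ?thesis using card_le_if_odd by auto
  next
    case 4
    then show ?thesis using card_le_9_if_8 by simp
  next
    case 5
    then show ?thesis using nine gp_torus_7.card_neq_10_if_10[OF sub] by simp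
  next
    case 6
    then show ?thesis using card_le_if_odd card_neq_11_if_11 by simp
  next
    case 7
    have "card T \<noteq> 10" if "T \<subseteq> S" for T
    proof
      assume "card T = 10"
      then have "ten_points n T X Y"
        using sub[OF that] 7 by (simp add: ten_points_def ten_points_axioms_def)
      then show False by (rule ten_points.contradiction)
    qed
    then show ?thesis using nine 7 by simp
  qed
qed

end

text \<open>
  Fewer than nine levels leave no room for three levels at mutual distance at least 3, on which the
  construction in \<open>torus_gp_three_levels\<close> rests. The sets with ten points realise the exceptional
  values.
\<close>
lemma torus_gp_witnesses:
  "torus_gp 7 3 ({0, 2, 4} \<times> {0, 1, 2})"
  "torus_gp 7 5 {(0, 0), (0, 1), (0, 3), (2, 0), (2, 1), (3, 3), (5, 0), (5, 2), (5, 3)}"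
  "torus_gp 7 6 {(0, 0), (1, 2), (1, 4), (3, 1), (3, 3), (3, 5), (5, 1), (5, 5), (6, 3)}"
  "torus_gp 7 8 {(0, 0), (0, 3), (1, 6), (3, 2), (3, 5), (3, 7), (5, 0), (6, 3), (6, 5)}"
  "torus_gp 7 7 {(0, 0), (2, 1), (0, 2), (4, 2), (2, 3), (4, 4), (6, 4), (1, 5), (3, 6), (5, 6)}"
  "torus_gp 7 9 {(0, 0), (3, 2), (0, 3), (5, 3), (2, 4), (4, 5), (6, 6), (1, 7), (3, 8), (5, 8)}"
  "torus_gp 7 11 {(0, 0), (3, 2), (5, 3), (0, 4), (2, 5), (4, 6), (6, 7), (1, 8), (3, 9), (5, 10)}"
  unfolding torus_gp_def by code_simp+

text \<open>
  Two of the three gaps between the levels are \<open>a\<close> and the third one is \<open>a\<close>, \<open>a + 1\<close> or \<open>a + 2\<close>. All gaps are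
  at least 3 and thus are the distances between points on different levels, and no gap is the sum of
  the other two. On one level the distances are 2 or 3.
\<close>
lemma torus_gp_three_levels:
  assumes "t \<ge> 9"
  defines "a \<equiv> t div 3"
  shows "torus_gp 7 t ({0, 2, 4} \<times> {0, a, 2 * a})"
proof -
  define S where "S = {0, 2, 4 :: nat} \<times> {0, a, 2 * a}"
  have a3: "a \<ge> 3" and t: "3 * a \<le> t" "t \<le> 3 * a + 2" using assms by (auto simp: a_def)
  have c: "cyc_norm (int t) (int a) = int a" "cyc_norm (int t) (2 * int a) = int t - 2 * int a"
    using cyc_norm_small[of "int t" "int a"] cyc_norm_large[of "int t" "2 * int a"] a3 t by auto
  have c': "cyc_norm (int t) (- (2 * int a)) = int t - 2 * int a"
    using c(2) by simp
  have level: "2 \<le> torus_dist 7 t p q \<and> torus_dist 7 t p q \<le> 3"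
    if "p \<in> S" "q \<in> S" "p \<noteq> q" "snd p = snd q" for p q
    using that by (auto simp: S_def torus_dist_def cyc_norm_def)
  have cross: "torus_dist 7 t p q = nat (cyc_norm (int t) (int (snd p) - int (snd q))) \<and>
      a \<le> torus_dist 7 t p q \<and> torus_dist 7 t p q \<le> a + 2"
    if "p \<in> S" "q \<in> S" "snd p \<noteq> snd q" for p q
  proof -
    have "snd p \<in> {0, a, 2 * a}" "snd q \<in> {0, a, 2 * a}" using that by (auto simp: S_def)
    then have "int (snd p) - int (snd q) \<in> {int a, - int a, 2 * int a, - (2 * int a)}"
      using that(3) by auto
    then have y: "cyc_norm (int t) (int (snd p) - int (snd q)) \<in> {int a, int t - 2 * int a}"
      using c c' by auto
    have x: "cyc_norm 7 (int (fst p) - int (fst q)) \<le> 3"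
      using cyc_norm_le_half[of 7 "int (fst p) - int (fst q)"] by simp
    have "nat (max x y) = nat y \<and> a \<le> nat (max x y) \<and> nat (max x y) \<le> a + 2"
      if "y \<in> {int a, int t - 2 * int a}" "x \<le> 3" for x y
      using that a3 t by auto
    from this[OF y x] show ?thesis unfolding torus_dist_def of_nat_numeral .
  qed
  have "torus_dist 7 t u v \<noteq> torus_dist 7 t u w + torus_dist 7 t w v"
    if S: "u \<in> S" "v \<in> S" "w \<in> S" and ne: "u \<noteq> v" "w \<noteq> u" "w \<noteq> v" for u v w
  proof -
    consider "snd u = snd v" "snd w = snd v" | "snd u = snd v" "snd w \<noteq> snd v"
      | "snd w = snd u" "snd u \<noteq> snd v" | "snd w = snd v" "snd u \<noteq> snd v"
      | "snd w \<noteq> snd u" "snd w \<noteq> snd v" "snd u \<noteq> snd v"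
      by metis
    then show ?thesis
    proof cases
      case 1
      then show ?thesis using level[of u v] level[of u w] level[of w v] S ne by auto
    next
      case 2
      then show ?thesis using level[of u v] cross[of u w] cross[of w v] S ne a3 by auto
    next
      case 3
      then show ?thesis using level[of u w] cross[of u v] cross[of w v] S ne by auto
    next
      case 4
      then show ?thesis using level[of w v] cross[of u v] cross[of u w] S ne by auto
    next
      case 5
      then show ?thesis using cross[of u v] cross[of u w] cross[of w v] S a3 by auto
    qed
  qed
  note geodesic_free = this
  show ?thesis
    unfolding torus_gp_def S_def[symmetric] by (intro ballI impI) (rule geodesic_free)
qed

theorem theorem4p9:
  fixes t :: nat
  assumes "t \<ge> 3" and "t \<noteq> 4"
  shows "gp (cycle_graph 7 \<boxtimes> cycle_graph t) = (if t \<in> {7, 9, 11} then 10 else 9)"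
proof -
  define N :: nat where "N = (if t \<in> {7, 9, 11} then 10 else 9)"
  have gp_iff: "general_position_set (cycle_graph 7 \<boxtimes> cycle_graph t) S \<longleftrightarrow>
      S \<subseteq> {0..<7} \<times> {0..<t} \<and> torus_gp 7 t S" for S
    using assms by (intro general_position_set_torus_iff) auto
  have upper: "card S \<le> N" if "general_position_set (cycle_graph 7 \<boxtimes> cycle_graph t) S" for S
  proof -
    have "gp_torus_7 (int t) S (\<lambda>p. int (fst p)) (\<lambda>p. int (snd p))"
      unfolding gp_torus_7_def using gp_torus_of_torus_gp[of 7 t S] that assms by (simp add: gp_iff)
    from gp_torus_7.card_le[OF this] show ?thesis using assms by (auto simp: N_def split: if_splits)
  qed
  have lower: "\<exists>S. general_position_set (cycle_graph 7 \<boxtimes> cycle_graph t) S \<and> card S = N"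
  proof -
    have witness: ?thesis if "torus_gp 7 t S" "S \<subseteq> {0..<7} \<times> {0..<t}" "card S = N" for S
      using that gp_iff by blast
    consider "t = 3" | "t = 5" | "t = 6" | "t = 8" | "t = 7" | "t = 9" | "t = 11" | "t \<ge> 10" "t \<noteq> 11"
      using assms by linarith
    then show ?thesis
    proof cases
      case 1
      with torus_gp_witnesses(1) show ?thesis
        by (intro witness[of "{0, 2, 4} \<times> {0, 1, 2}"]) (auto simp: N_def card_cartesian_product)
    next
      case 2
      with torus_gp_witnesses(2) show ?thesis by (intro witness) (auto simp: N_def)
    next
      case 3
      with torus_gp_witnesses(3) show ?thesis by (intro witness) (auto simp: N_def)
    next
      case 4
      with torus_gp_witnesses(4) show ?thesis by (intro witness) (auto simp: N_def)
    next
      case 5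
      with torus_gp_witnesses(5) show ?thesis by (intro witness) (auto simp: N_def)
    next
      case 6
      with torus_gp_witnesses(6) show ?thesis by (intro witness) (auto simp: N_def)
    next
      case 7
      with torus_gp_witnesses(7) show ?thesis by (intro witness) (auto simp: N_def)
    next
      case 8
      show ?thesis
      proof (rule witness)
        show "torus_gp 7 t ({0, 2, 4} \<times> {0, t div 3, 2 * (t div 3)})"
          using 8 by (intro torus_gp_three_levels) simp
        show "{0, 2, 4 :: nat} \<times> {0, t div 3, 2 * (t div 3)} \<subseteq> {0..<7} \<times> {0..<t}" using 8 by auto
        show "card ({0, 2, 4 :: nat} \<times> {0, t div 3, 2 * (t div 3)}) = N"
          using 8 by (simp add: N_def card_cartesian_product)
      qed
    qed
  qed
  have "finite {card S | S. general_position_set (cycle_graph 7 \<boxtimes> cycle_graph t) S}"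
    by (rule finite_subset[of _ "{..N}"]) (use upper in auto)
  then show ?thesis
    unfolding gp_def N_def[symmetric] using upper lower by (intro Max_eqI) auto
qed

end
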